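(* Let $\mathbb{K}$ be a field of characteristic zero, and let $I\subset S=\mathbb{K}[x_1,x_2,x_3]$ be an artinian monomial ideal generated in degree $d$, for $d\ge 2$, such that $S/I$ fails to have the weak Lefschetz property. Then $$H_{S/I}(d)\ \ge\ \begin{cases}3d-3 & \text{if } d \text{ is odd},\\ 3d-2 & \text{if } d\text{ is even}.\end{cases}$$ Furthermore, the bounds are sharp.
   Context: $S$ has the standard grading, $\deg x_i=1$. An ideal is "generated in degree $d$" if it is generated by homogeneous elements, all of degree $d$. $H_{S/I}(d)=\dim_{\mathbb{K}}(S/I)_d$ is the Hilbert function of $S/I$ in degree $d$. For a homogeneous artinian ideal $I$, $S/I$ has the weak Lefschetz property (WLP) if there is a linear form $\ell\in (S/I)_1$ such that for all integers $j$ the multiplication map $\times\ell:(S/I)_j\to(S/I)_{j+1}$ has maximal rank, i.e. is injective or surjective; otherwise $S/I$ fails the WLP.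
   Formalization: Sharpness is stated for every d ≥ 3 only: for d = 2 the ideal contains x_1^2, x_2^2, x_3^2, so H_{S/I}(2) ≤ 3 < 4 and the bound cannot be attained; the lower bound itself is stated for all d ≥ 2. *)

theory Defs
  imports
    "HOL-Library.Poly_Mapping"
    "HOL-Library.Numeral_Type"
    "HOL-Algebra.Embedded_Algebras"
    "HOL-Algebra.QuotRing"
    "HOL-Algebra.Algebraic_Closure_Type"
begin

text \<open>
  The polynomial ring \<open>S\<close> in three variables over \<open>'k\<close>: finitely supported functions from exponent
  vectors to coefficients, with the convolution product.  The variables are indexed by the
  three-element type \<open>3\<close>.
\<close>

type_synonym 'k poly3 = "(3 \<Rightarrow>\<^sub>0 nat) \<Rightarrow>\<^sub>0 'k"

abbreviation poly3_ring :: "'k::field poly3 ring" where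
  "poly3_ring \<equiv> ring_of_type_algebra"

definition mon_degree :: "(3 \<Rightarrow>\<^sub>0 nat) \<Rightarrow> nat" where
  "mon_degree m = (\<Sum>i\<in>UNIV. Poly_Mapping.lookup m i)"

text \<open>The graded component of degree \<open>j\<close>; it contains \<open>0\<close>, whose set of keys is empty.\<close>

definition homogeneous_part :: "nat \<Rightarrow> 'k::field poly3 set" where
  "homogeneous_part j = {f. \<forall>m\<in>Poly_Mapping.keys f. mon_degree m = j}"

definition monomials :: "'k::field poly3 set" where
  "monomials = range (\<lambda>m. Poly_Mapping.single m 1)"

definition monomial_ideal :: "'k::field poly3 set \<Rightarrow> bool" where
  "monomial_ideal I \<longleftrightarrow> (\<exists>M. M \<subseteq> monomials \<and> I = Idl\<^bsub>poly3_ring\<^esub> M)"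

definition generated_in_degree :: "nat \<Rightarrow> 'k::field poly3 set \<Rightarrow> bool" where
  "generated_in_degree d I \<longleftrightarrow> (\<exists>G. G \<subseteq> homogeneous_part d \<and> I = Idl\<^bsub>poly3_ring\<^esub> G)"

definition artinian_ring :: "('a, 'b) ring_scheme \<Rightarrow> bool" where
  "artinian_ring R \<longleftrightarrow>
     (\<forall>J :: nat \<Rightarrow> 'a set. (\<forall>n. ideal (J n) R) \<and> (\<forall>n. J (Suc n) \<subseteq> J n) \<longrightarrow>
        (\<exists>N. \<forall>n\<ge>N. J n = J N))"

definition artinian_ideal :: "'k::field poly3 set \<Rightarrow> bool" where
  "artinian_ideal I \<longleftrightarrow> ideal I poly3_ring \<and> artinian_ring (poly3_ring Quot I)"

text \<open>The graded component of degree \<open>j\<close> of \<open>S/I\<close>, for a homogeneous ideal \<open>I\<close>.\<close>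

definition quot_part :: "'k::field poly3 set \<Rightarrow> nat \<Rightarrow> 'k poly3 set set" where
  "quot_part I j = (\<lambda>f. I +>\<^bsub>poly3_ring\<^esub> f) ` homogeneous_part j"

text \<open>The image of the coefficient field in \<open>S/I\<close>; a subfield of \<open>S/I\<close> when \<open>I\<close> is proper.\<close>

definition quot_scalars :: "'k::field poly3 set \<Rightarrow> 'k poly3 set set" where
  "quot_scalars I = range (\<lambda>c. I +>\<^bsub>poly3_ring\<^esub> Poly_Mapping.single 0 c)"

definition hilbert_function :: "'k::field poly3 set \<Rightarrow> nat \<Rightarrow> nat" where
  "hilbert_function I d = ring.dim (poly3_ring Quot I) (quot_scalars I) (quot_part I d)"

text \<open>
  Only degrees \<open>j \<ge> 0\<close> are considered: for negative \<open>j\<close> the component of degree \<open>j\<close> is zero, so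
  multiplication out of it is injective.
\<close>

definition weak_lefschetz :: "'k::field poly3 set \<Rightarrow> bool" where
  "weak_lefschetz I \<longleftrightarrow>
     (\<exists>l\<in>quot_part I 1. \<forall>j.
        inj_on (\<lambda>a. l \<otimes>\<^bsub>poly3_ring Quot I\<^esub> a) (quot_part I j) \<or>
        (\<lambda>a. l \<otimes>\<^bsub>poly3_ring Quot I\<^esub> a) ` quot_part I j = quot_part I (Suc j))"

end

theory Submission
  imports Defs "HOL-Computational_Algebra.Polynomial"
begin

text \<open>
  Below degree \<open>d - 1\<close> multiplication by \<open>x + y + z\<close> is injective, and surjectivity propagates upwards, so
  only degree \<open>d - 1\<close> matters.  Multiplication by \<open>x + y + z\<close> from degree \<open>d - 1\<close> to degree \<open>d\<close> of \<open>S/I\<close> fails to be surjective iff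
  some nonzero functional \<open>\<phi>\<close> on \<open>S\<^sub>d\<close> vanishes on \<open>I\<close> and satisfies
  \<open>\<phi>(xm) + \<phi>(ym) + \<phi>(zm) = 0\<close> for all monomials \<open>m\<close> of degree \<open>d - 1\<close>.  Up to the sign \<open>(-1)\<^sup>i\<close>, the values
  \<open>\<phi>(x\<^sup>i y\<^sup>j z\<^sup>k)\<close> with \<open>k\<close> fixed are the values on \<open>{0..d-k}\<close> of the \<open>k\<close>-th finite difference of one
  polynomial \<open>p\<close>; since \<open>I\<close> contains the pure powers, \<open>p(0) = p(d) = 0\<close> and \<open>deg p < d\<close>.  The Hilbert
  function in degree \<open>d\<close> is at least the number of nonzero entries of this difference triangle.  Each row
  is bounded by counting roots, which gives at least \<open>3d - 3\<close> unless \<open>deg p = d - 1\<close>.  In that case let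
  \<open>{0..n}\<close> be the longest row with exactly two nonzero entries: the triangle below it is explicit,
  and all rows above have at least three.  Parity enters through a few explicit exceptional rows.

  The extremal functional comes from \<open>p = x(x - d)\<close>, which has only three nonzero differences; it is
  dual to \<open>(x - y)\<^bsup>d-2\<^esup>(y - z)(x - z)\<close>.
\<close>

section \<open>Finite differences of polynomials on initial segments\<close>

text \<open>Write e for the degree of \<open>p\<close>. Row k has d - k + 1 entries and degree e -
  k, so at least d - e + 1 of its entries are nonzero, and the rows 0, ..., e together give (e +
  1)(d - e + 1). On 2 <= e <= d - 2 this product is smallest at the two ends, where it equals 3d -
  3. At e = d - 1 it is only 2d, which is the obstacle behind most of the work: rows with just two
  nonzero entries occur. The triangle below such a row {0..n} can have fewer than 3n - 3 nonzero
  entries only if the two sit at the edge of the row. That deficit is repaid above it: the long run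
  of zeros makes \<open>p\<close> a falling factorial plus a correction of low degree, so each row
  above has at least n nonzero entries. For even d one more entry must be found wherever the count
  stops at 3d - 3. The main tool is that the three top rows cannot have exactly three nonzero
  entries each when d >= 6: this would fix the positions and ratios of the values so tightly that
  the vanishing of the d-th difference becomes a quadratic equation for d, with roots among 2, 4,
  5.\<close>

definition fd :: "'a::field_char_0 poly \<Rightarrow> 'a poly" where
  "fd p = pcompose p [:1, 1:] - p"

lemma poly_fd: "poly (fd p) x = poly p (x + 1) - poly p x"
  by (simp add: fd_def poly_pcompose add.commute)

lemma fd_pCons: "fd (pCons a p) = [:1, 1:] * fd p + p"
  by (simp add: fd_def pcompose_pCons algebra_simps)

lemma fd_0 [simp]: "fd 0 = 0"
  by (simp add: fd_def)

lemma fd_add: "fd (p + q) = fd p + fd q"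
  by (simp add: fd_def pcompose_add)

lemma fd_smult: "fd (smult c p) = smult c (fd p)"
  by (simp add: fd_def pcompose_smult smult_diff_right)

lemma fd_pow_0 [simp]: "(fd ^^ k) 0 = 0"
  by (induction k) auto

lemma fd_pow_add: "(fd ^^ k) (p + q) = (fd ^^ k) p + (fd ^^ k) q"
  by (induction k) (auto simp: fd_add)

lemma fd_pow_smult: "(fd ^^ k) (smult c p) = smult c ((fd ^^ k) p)"
  by (induction k) (auto simp: fd_smult)

text \<open>Differencing treats the top coefficient as the derivative does. Assuming only a degree
  bound lets the induction pass through vanishing top coefficients; in characteristic zero the
  factor \<open>Suc n\<close> then gives the exact degree drop.\<close>

lemma fd_coeffs:
  assumes "degree p \<le> Suc n"
  shows "degree (fd p) \<le> n \<and> coeff (fd p) n = of_nat (Suc n) * coeff p (Suc n)"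
  using assms
proof (induction p arbitrary: n)
  case 0
  then show ?case by simp
next
  case (pCons a p)
  have dp: "degree p \<le> n"
    using pCons.prems pCons.hyps by (auto split: if_splits)
  show ?case
  proof (cases n)
    case 0
    then obtain b where "p = [:b:]"
      using dp degree_eq_zeroE by blast
    then show ?thesis using 0 by (simp add: fd_def pcompose_pCons)
  next
    case (Suc k)
    have IH: "degree (fd p) \<le> k" "coeff (fd p) k = of_nat (Suc k) * coeff p (Suc k)"
      using pCons.IH[of k] dp Suc by auto
    have "degree ([:1, 1:] * fd p) \<le> Suc k"
      using degree_mult_le[of "[:1,1:]" "fd p"] IH(1) by simp
    then have "degree (fd (pCons a p)) \<le> n"
      unfolding fd_pCons using dp Suc by (intro degree_add_le) auto
    moreover have "coeff (fd p) (Suc k) = 0"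
      using IH(1) by (simp add: coeff_eq_0)
    ultimately show ?thesis
      using IH Suc by (simp add: fd_pCons algebra_simps)
  qed
qed

lemma degree_fd:
  assumes "degree p = Suc n"
  shows "degree (fd p) = n"
proof -
  have "coeff (fd p) n \<noteq> 0"
    using fd_coeffs[of p n] assms
    by (metis le_refl leading_coeff_0_iff mult_eq_0_iff nat.distinct(1) of_nat_eq_0_iff degree_0)
  then show ?thesis
    using fd_coeffs[of p n] assms by (simp add: le_antisym le_degree)
qed

lemma fd_const: "degree p = 0 \<Longrightarrow> fd p = 0"
  by (metis fd_def degree_eq_zeroE pcompose_const diff_self)

lemma degree_fd_pow: "degree ((fd ^^ k) p) = degree p - k"
proof (induction k)
  case (Suc k)
  show ?case
  proof (cases "degree ((fd ^^ k) p)")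
    case 0
    then show ?thesis using Suc fd_const[of "(fd ^^ k) p"] by simp
  next
    case (Suc m)
    then show ?thesis using degree_fd[OF Suc] Suc.IH by simp
  qed
qed auto

lemma fd_pow_nonzero:
  assumes "p \<noteq> 0" "k \<le> degree p"
  shows "(fd ^^ k) p \<noteq> 0"
  using assms(2)
proof (induction k)
  case 0
  then show ?case using assms(1) by simp
next
  case (Suc k)
  have "degree ((fd ^^ k) p) = Suc (degree p - Suc k)"
    using Suc.prems by (simp add: degree_fd_pow)
  then have "coeff (fd ((fd ^^ k) p)) (degree p - Suc k) \<noteq> 0"
    using fd_coeffs[of "(fd ^^ k) p" "degree p - Suc k"]
    by (metis le_refl leading_coeff_0_iff mult_eq_0_iff nat.distinct(1) of_nat_eq_0_iff degree_0)
  then show ?case by auto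
qed

lemma fd_pow_zero:
  assumes "degree p < k"
  shows "(fd ^^ k) p = 0"
proof -
  obtain j where k: "k = Suc (degree p + j)"
    using assms less_imp_Suc_add by blast
  have "degree ((fd ^^ (degree p + j)) p) = 0"
    by (simp add: degree_fd_pow)
  then show ?thesis using fd_const by (simp add: k)
qed

definition nz :: "nat \<Rightarrow> 'a::field_char_0 poly \<Rightarrow> nat set" where
  "nz n q = {i. i \<le> n \<and> poly q (of_nat i) \<noteq> 0}"

lemma nz_iff: "i \<in> nz n q \<longleftrightarrow> i \<le> n \<and> poly q (of_nat i) \<noteq> 0"
  by (simp add: nz_def)

lemma finite_nz [simp]: "finite (nz n q)"
  by (rule finite_subset[of _ "{..n}"]) (auto simp: nz_def)

text \<open>Characteristic zero enters here: distinct naturals are distinct field elements, so at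
  most \<open>degree q\<close> of them are roots.\<close>

lemma card_nonroots:
  fixes q :: "'a::field_char_0 poly"
  assumes "q \<noteq> 0" "finite A"
  shows "card A \<le> card {i \<in> A. poly q (of_nat i) \<noteq> 0} + degree q"
proof -
  let ?Z = "{i \<in> A. poly q (of_nat i) = 0}"
  have "card ?Z = card ((of_nat :: nat \<Rightarrow> 'a) ` ?Z)"
    by (rule card_image[symmetric]) (auto simp: inj_on_def)
  also have "\<dots> \<le> card {x. poly q x = 0}"
    using assms(1) by (intro card_mono poly_roots_finite) auto
  also have "\<dots> \<le> degree q"
    using assms(1) by (rule card_poly_roots_bound)
  finally have "card ?Z \<le> degree q" .
  moreover have "A = ?Z \<union> {i \<in> A. poly q (of_nat i) \<noteq> 0}" by auto
  then have "card A = card ?Z + card {i \<in> A. poly q (of_nat i) \<noteq> 0}"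
    using assms(2) by (subst \<open>A = _\<close>, subst card_Un_disjoint) auto
  ultimately show ?thesis by simp
qed

lemma card_nz_ge:
  assumes "q \<noteq> 0"
  shows "n + 1 \<le> card (nz n q) + degree q"
  using card_nonroots[OF assms, of "{..n}"] by (simp add: nz_def)

definition total_nz :: "nat \<Rightarrow> 'a::field_char_0 poly \<Rightarrow> nat" where
  "total_nz n q = (\<Sum>k\<le>n. card (nz (n - k) ((fd ^^ k) q)))"

lemma total_nz_Suc: "total_nz (Suc m) q = card (nz (Suc m) q) + total_nz m (fd q)"
  unfolding total_nz_def by (subst sum.atMost_Suc_shift) (simp add: funpow_swap1)

lemma total_nz_split:
  assumes "K \<le> n"
  shows "total_nz n p = (\<Sum>k<K. card (nz (n - k) ((fd ^^ k) p))) + total_nz (n - K) ((fd ^^ K) p)"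
  using assms
proof (induction K)
  case (Suc K)
  then have "n - K = Suc (n - Suc K)" by simp
  then show ?case using Suc total_nz_Suc[of "n - Suc K" "(fd ^^ K) p"] by simp
qed simp

text \<open>The contribution of position \<open>u\<close> in the top row to position \<open>i\<close> of the \<open>j\<close>-th difference,
  up to the sign \<open>(-1)\<^bsup>i+j+u\<^esup>\<close>.\<close>

definition binom_at :: "nat \<Rightarrow> nat \<Rightarrow> nat \<Rightarrow> nat" where
  "binom_at j i u = (if i \<le> u then j choose (u - i) else 0)"

lemma binom_at_Suc: "binom_at (Suc j) i u = binom_at j (Suc i) u + binom_at j i u"
proof (cases "Suc i \<le> u")
  case True
  then have "u - i = Suc (u - Suc i)" by simp
  then show ?thesis using True by (simp add: binom_at_def)
qed (auto simp: binom_at_def)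

text \<open>The sign \<open>(-1) ^ (i + j)\<close> turns the difference recursion into a sum, so the
  coefficients obey Pascal's rule and are plain binomials.\<close>

lemma fd_pow_expand:
  assumes "i + j \<le> n"
  shows "(-1) ^ (i + j) * poly ((fd ^^ j) q) (of_nat i)
     = (\<Sum>u\<le>n. of_nat (binom_at j i u) * ((-1) ^ u * poly q (of_nat u)))"
  using assms
proof (induction j arbitrary: i)
  case 0
  have "(\<Sum>u\<le>n. of_nat (binom_at 0 i u) * ((-1) ^ u * poly q (of_nat u)))
     = (\<Sum>u\<in>{..n}. if u = i then (-1) ^ u * poly q (of_nat u) else 0)"
    by (intro sum.cong refl) (auto simp: binom_at_def)
  then show ?case using 0 by simp
next
  case (Suc j)
  have "(-1) ^ (i + Suc j) * poly ((fd ^^ Suc j) q) (of_nat i)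
     = (-1) ^ (Suc i + j) * poly ((fd ^^ j) q) (of_nat (Suc i))
       + (-1) ^ (i + j) * poly ((fd ^^ j) q) (of_nat i)"
    by (simp add: poly_fd algebra_simps)
  also have "\<dots> = (\<Sum>u\<le>n. of_nat (binom_at j (Suc i) u) * ((-1) ^ u * poly q (of_nat u)))
      + (\<Sum>u\<le>n. of_nat (binom_at j i u) * ((-1) ^ u * poly q (of_nat u)))"
    using Suc.IH[of "Suc i"] Suc.IH[of i] Suc.prems by simp
  also have "\<dots> = (\<Sum>u\<le>n. of_nat (binom_at (Suc j) i u) * ((-1) ^ u * poly q (of_nat u)))"
    by (simp add: sum.distrib[symmetric] binom_at_Suc distrib_right)
  finally show ?case .
qed

lemma alternating_sum_zero:
  fixes p :: "'a::field_char_0 poly"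
  assumes "degree p < d"
  shows "(\<Sum>u\<le>d. of_nat (d choose u) * ((-1) ^ u * poly p (of_nat u))) = 0"
  using fd_pow_expand[of 0 d d p] fd_pow_zero[OF assms] by (simp add: binom_at_def)

section \<open>Rows with exactly two nonzero values\<close>

lemma two_nz_value:
  fixes q :: "'a::field_char_0 poly"
  assumes "nz n q = {u, v}" "u < v" "i + j \<le> n"
  shows "(-1) ^ (i + j) * poly ((fd ^^ j) q) (of_nat i)
     = of_nat (binom_at j i u) * ((-1) ^ u * poly q (of_nat u))
       + of_nat (binom_at j i v) * ((-1) ^ v * poly q (of_nat v))"
proof -
  have sub: "{u, v} \<subseteq> {..n}" using assms(1) by (auto simp: nz_def)
  have "(\<Sum>w\<le>n. of_nat (binom_at j i w) * ((-1) ^ w * poly q (of_nat w)))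
     = (\<Sum>w\<in>{u, v}. of_nat (binom_at j i w) * ((-1) ^ w * poly q (of_nat w)))"
  proof (rule sum.mono_neutral_right[OF _ sub])
    show "\<forall>w\<in>{..n} - {u, v}. of_nat (binom_at j i w) * ((-1) ^ w * poly q (of_nat w)) = 0"
      using assms(1) by (auto simp: nz_def set_eq_iff)
  qed auto
  then show ?thesis using fd_pow_expand[OF assms(3), of q] assms(2) by simp
qed

text \<open>Replacing the row index by the second distance i' = n - k - i turns the region reached
  by a single top value into a rectangle.\<close>

lemma total_nz_eq_card:
  "total_nz n q = card {(i, i'). i + i' \<le> n \<and> poly ((fd ^^ (n - i - i')) q) (of_nat i) \<noteq> 0}"
proof -
  have "total_nz n q = card (SIGMA k:{..n}. nz (n - k) ((fd ^^ k) q))"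
    by (simp add: total_nz_def)
  also have "\<dots> = card {(i, i'). i + i' \<le> n \<and> poly ((fd ^^ (n - i - i')) q) (of_nat i) \<noteq> 0}"
    by (rule bij_betw_same_card[of "\<lambda>(k, i). (i, n - k - i)"],
        rule bij_betwI[where g = "\<lambda>(i, i'). (n - i - i', i)"])
       (auto simp: nz_def)
  finally show ?thesis .
qed

text \<open>Both sides are the multinomial coefficient of x + y + e over x, e, y. It gives the ratio
  of the weights with which the two nonzero values enter one entry.\<close>

lemma choose_shift:
  fixes x y e :: nat
  shows "(x + y + e choose (x + e)) * (x + e choose e) = (x + y + e choose x) * (y + e choose e)"
  using choose_mult[of x "x + e" "x + y + e"] binomial_symmetric[of x "x + e"]
  by (simp add: add.commute add.left_commute)

text \<open>Makes the cancellation relation in \<open>two_nz_total\<close> determine i from i' and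
  conversely.\<close>

lemma choose_strict_mono: "0 < e \<Longrightarrow> strict_mono (\<lambda>x. x + e choose e)"
  unfolding strict_mono_Suc_iff
proof
  fix x assume "0 < e"
  then obtain k where "e = Suc k" using gr0_implies_Suc by blast
  then show "x + e choose e < Suc x + e choose e" by simp
qed

lemma card_diagonal_le:
  fixes Z :: "(nat \<times> nat) set"
  assumes "Z \<subseteq> {..a} \<times> {..b}"
    and "\<And>i j j'. (i, j) \<in> Z \<Longrightarrow> (i, j') \<in> Z \<Longrightarrow> j = j'"
    and "\<And>i i' j. (i, j) \<in> Z \<Longrightarrow> (i', j) \<in> Z \<Longrightarrow> i = i'"
  shows "card Z \<le> a + 1" "card Z \<le> b + 1"
proof -
  have "card Z \<le> card {..a}"
    by (rule card_inj_on_le[of fst]) (use assms in \<open>auto simp: inj_on_def\<close>)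
  then show "card Z \<le> a + 1" by simp
  have "card Z \<le> card {..b}"
    by (rule card_inj_on_le[of snd]) (use assms in \<open>auto simp: inj_on_def\<close>)
  then show "card Z \<le> b + 1" by simp
qed

text \<open>The entries of the triangle are indexed by \<open>(i, i')\<close>, the distances to its two slanted sides.  A nonzero
  value at \<open>u\<close> reaches the rectangle \<open>i \<le> u, i' \<le> e + b\<close>, one at \<open>u + e\<close> the rectangle
  \<open>i \<le> u + e, i' \<le> b\<close>.  Cancellation is only possible on the overlap, at a set \<open>Z\<close> which meets every line
  \<open>i = const\<close> and \<open>i' = const\<close> at most once.\<close>

lemma two_nz_total:
  fixes q :: "'a::field_char_0 poly"
  assumes deg: "degree q < u + e + b" and nz: "nz (u + e + b) q = {u, u + e}" and e: "0 < e"
  obtains Z where "Z \<subseteq> {..u} \<times> {..b}"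
    "e * (u + b + 2) + (u + 1) * (b + 1) \<le> total_nz (u + e + b) q + card Z"
    "\<And>i i'. (i, i') \<in> Z \<Longrightarrow> (b + e choose e) * (u - i + e choose e) = (u + e choose e) * (b - i' + e choose e)"
proof -
  define n where "n = u + e + b"
  define A where "A = (-1) ^ u * poly q (of_nat u)"
  define B where "B = (-1) ^ (u + e) * poly q (of_nat (u + e))"
  have nz': "nz n q = {u, u + e}" using nz by (simp add: n_def)
  have A0: "A \<noteq> 0" and B0: "B \<noteq> 0"
  proof -
    have "u \<in> nz n q" "u + e \<in> nz n q" using nz' by simp_all
    then show "A \<noteq> 0" "B \<noteq> 0" unfolding A_def B_def nz_iff by simp_all
  qed
  define T where "T = {(i, i'). i + i' \<le> n \<and> poly ((fd ^^ (n - i - i')) q) (of_nat i) \<noteq> 0}"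
  have finT: "finite T"
    by (rule finite_subset[of _ "{..n} \<times> {..n}"]) (auto simp: T_def)
  have T_iff: "(i, i') \<in> T \<longleftrightarrow>
      of_nat (binom_at (n - i - i') i u) * A + of_nat (binom_at (n - i - i') i (u + e)) * B \<noteq> 0"
    if "i + i' \<le> n" for i i'
  proof -
    have le: "i + (n - i - i') \<le> n" using that by simp
    have "(i, i') \<in> T \<longleftrightarrow> (-1) ^ (i + (n - i - i')) * poly ((fd ^^ (n - i - i')) q) (of_nat i) \<noteq> 0"
      using that by (simp add: T_def)
    then show ?thesis
      using e by (simp only: two_nz_value[OF nz' _ le] A_def B_def less_add_same_cancel1)
  qed
  define Z where "Z = {..u} \<times> {..b} - T"
  have S1: "{u<..u + e} \<times> {..b} \<subseteq> T"
  proof (rule subrelI)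
    fix i i' assume i: "(i, i') \<in> {u<..u + e} \<times> {..b}"
    then have "binom_at (n - i - i') i u = 0" "binom_at (n - i - i') i (u + e) \<noteq> 0"
      by (auto simp: binom_at_def n_def)
    moreover have "i + i' \<le> n" using i by (auto simp: n_def)
    ultimately show "(i, i') \<in> T" using B0 by (simp add: T_iff)
  qed
  have S2: "{..u} \<times> {b<..b + e} \<subseteq> T"
  proof (rule subrelI)
    fix i i' assume i: "(i, i') \<in> {..u} \<times> {b<..b + e}"
    then have "binom_at (n - i - i') i u \<noteq> 0" "binom_at (n - i - i') i (u + e) = 0"
      by (auto simp: binom_at_def n_def)
    moreover have "i + i' \<le> n" using i by (auto simp: n_def)
    ultimately show "(i, i') \<in> T" using A0 by (simp add: T_iff)
  qed
  \<comment> \<open>With x = u - i and y = b - i', the entry is a difference of order x + y + e, so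
    \<open>choose_shift\<close> applies.\<close>
  have rel: "binom_at (n - i - i') i (u + e) * (u - i + e choose e)
      = binom_at (n - i - i') i u * (b - i' + e choose e) \<and> binom_at (n - i - i') i u \<noteq> 0"
    if "i \<le> u" "i' \<le> b" for i i'
  proof -
    obtain x y where xy: "u = i + x" "b = i' + y"
      using \<open>i \<le> u\<close> \<open>i' \<le> b\<close> le_Suc_ex by blast
    then have "n - i - i' = x + y + e" "u + e - i = x + e" "u - i = x" "b - i' = y"
      by (auto simp: n_def)
    then show ?thesis
      using choose_shift[of x y e] that by (simp add: binom_at_def)
  qed
  have zero_rel: "A * of_nat (u - i + e choose e) + B * of_nat (b - i' + e choose e) = 0"
    if i: "i \<le> u" "i' \<le> b"
      and z: "of_nat (binom_at (n - i - i') i u) * A + of_nat (binom_at (n - i - i') i (u + e)) * B = 0"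
    for i i'
  proof -
    let ?X = "of_nat (binom_at (n - i - i') i u) :: 'a"
    let ?Y = "of_nat (binom_at (n - i - i') i (u + e)) :: 'a"
    let ?g = "of_nat (u - i + e choose e) :: 'a"
    let ?h = "of_nat (b - i' + e choose e) :: 'a"
    have r: "?Y * ?g = ?X * ?h" "?X \<noteq> 0"
      using rel[OF i] by (auto simp flip: of_nat_mult)
    have "?X * (A * ?g + B * ?h) = (?X * A + ?Y * B) * ?g"
      using r(1) by (simp add: algebra_simps)
    then show ?thesis using z r(2) by simp
  qed
  \<comment> \<open>The corner i = i' = 0 is the n-th difference, zero by the degree bound. This
    fixes the ratio of \<open>A\<close> and \<open>B\<close>, so the description of \<open>Z\<close>
    no longer mentions \<open>q\<close>.\<close>
  have base: "A * of_nat (u + e choose e) + B * of_nat (b + e choose e) = 0"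
  proof -
    have "(fd ^^ n) q = 0" using deg by (intro fd_pow_zero) (simp add: n_def)
    then have "of_nat (binom_at n 0 u) * A + of_nat (binom_at n 0 (u + e)) * B = 0"
      using two_nz_value[OF nz', of 0 n] e by (simp add: A_def B_def)
    then show ?thesis using zero_rel[of 0 0] by simp
  qed
  show ?thesis
  proof (rule that[of Z])
    show "Z \<subseteq> {..u} \<times> {..b}" by (auto simp: Z_def)
    \<comment> \<open>Three disjoint blocks: entries reached only by the value at
      \<open>u + e\<close>, only by the value at \<open>u\<close>, and by both without
      cancelling.\<close>
    have "card ({u<..u + e} \<times> {..b} \<union> {..u} \<times> {b<..b + e} \<union> ({..u} \<times> {..b} - Z)) \<le> card T"
      using S1 S2 finT by (intro card_mono) (auto simp: Z_def)
    moreover have "card ({u<..u + e} \<times> {..b} \<union> {..u} \<times> {b<..b + e} \<union> ({..u} \<times> {..b} - Z))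
       = e * (b + 1) + (u + 1) * e + ((u + 1) * (b + 1) - card Z)"
      by (subst card_Un_disjoint, simp, simp, force, subst card_Un_disjoint)
         (auto simp: card_Diff_subset Z_def finite_subset[of _ "{..u} \<times> {..b}"])
    moreover have "card Z \<le> (u + 1) * (b + 1)"
      using card_mono[of "{..u} \<times> {..b}" Z] by (auto simp: Z_def)
    ultimately show "e * (u + b + 2) + (u + 1) * (b + 1) \<le> total_nz (u + e + b) q + card Z"
      unfolding total_nz_eq_card T_def[unfolded n_def, symmetric] by (simp add: algebra_simps)
    fix i i' assume Z: "(i, i') \<in> Z"
    then have i: "i \<le> u" "i' \<le> b" by (auto simp: Z_def)
    have "i + i' \<le> n" using i by (simp add: n_def)
    then have "A * of_nat (u - i + e choose e) + B * of_nat (b - i' + e choose e) = 0"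
      using Z i zero_rel by (simp add: Z_def T_iff)
    then have r: "A * of_nat (u - i + e choose e) = - (B * of_nat (b - i' + e choose e))"
      by (simp add: eq_neg_iff_add_eq_0)
    have r0: "A * of_nat (u + e choose e) = - (B * of_nat (b + e choose e))"
      using base by (simp add: eq_neg_iff_add_eq_0)
    \<comment> \<open>Both relations express a multiple of \<open>A\<close> through
      \<open>B\<close>; cross-multiplication eliminates \<open>B\<close>, and \<open>A\<close> is
      nonzero.\<close>
    have "A * (of_nat (b + e choose e) * of_nat (u - i + e choose e)
        - of_nat (u + e choose e) * of_nat (b - i' + e choose e))
      = of_nat (b + e choose e) * (A * of_nat (u - i + e choose e))
        - of_nat (b - i' + e choose e) * (A * of_nat (u + e choose e))"
      by (simp only: algebra_simps)
    also have "\<dots> = 0" unfolding r r0 by (simp only: algebra_simps) simp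
    finally have "A * (of_nat (b + e choose e) * of_nat (u - i + e choose e)
        - of_nat (u + e choose e) * of_nat (b - i' + e choose e)) = 0" .
    then have "(of_nat ((b + e choose e) * (u - i + e choose e)) :: 'a)
        = of_nat ((u + e choose e) * (b - i' + e choose e))"
      using A0 by simp
    then show "(b + e choose e) * (u - i + e choose e) = (u + e choose e) * (b - i' + e choose e)"
      using of_nat_eq_iff by blast
  qed
qed

text \<open>Cancellations form a partial matching of the two coordinates, whence the bounds by
  \<open>u + 1\<close> and \<open>b + 1\<close>. For e = 1 the relation is linear; if moreover one
  of u, b is 1 and n is even, any cancellation away from the corner would make an odd number
  even.\<close>

lemma two_nz_total_bound:
  fixes q :: "'a::field_char_0 poly"
  assumes deg: "degree q < u + e + b" and nz: "nz (u + e + b) q = {u, u + e}" and e: "0 < e"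
  obtains z where "e * (u + b + 2) + (u + 1) * (b + 1) \<le> total_nz (u + e + b) q + z"
    "z \<le> u + 1" "z \<le> b + 1" "e = 1 \<Longrightarrow> u = 1 \<or> b = 1 \<Longrightarrow> even (u + e + b) \<Longrightarrow> z \<le> 1"
proof -
  obtain Z where Z: "Z \<subseteq> {..u} \<times> {..b}"
    "e * (u + b + 2) + (u + 1) * (b + 1) \<le> total_nz (u + e + b) q + card Z"
    "\<And>i i'. (i, i') \<in> Z \<Longrightarrow> (b + e choose e) * (u - i + e choose e) = (u + e choose e) * (b - i' + e choose e)"
    using two_nz_total[OF assms] by blast
  have pos: "0 < (u + e choose e)" "0 < (b + e choose e)" by auto
  note inj = strict_mono_eq[OF choose_strict_mono[OF e]]
  have Zle: "card Z \<le> u + 1" "card Z \<le> b + 1"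
  proof -
    have *: "j = j'" if "(i, j) \<in> Z" "(i, j') \<in> Z" for i j j'
    proof -
      have "(u + e choose e) * (b - j + e choose e) = (u + e choose e) * (b - j' + e choose e)"
        using Z(3)[OF that(1)] Z(3)[OF that(2)] by simp
      then have "b - j = b - j'" using pos inj by simp
      moreover have "j \<le> b" "j' \<le> b" using that Z(1) by auto
      ultimately show ?thesis by simp
    qed
    have **: "i = i'" if "(i, j) \<in> Z" "(i', j) \<in> Z" for i i' j
    proof -
      have "(b + e choose e) * (u - i + e choose e) = (b + e choose e) * (u - i' + e choose e)"
        using Z(3)[OF that(1)] Z(3)[OF that(2)] by simp
      then have "u - i = u - i'" using pos inj by simp
      moreover have "i \<le> u" "i' \<le> u" using that Z(1) by auto
      ultimately show ?thesis by simp
    qed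
    show "card Z \<le> u + 1"
      by (rule card_diagonal_le(1)[OF Z(1)]) (fact * **)+
    show "card Z \<le> b + 1"
      by (rule card_diagonal_le(2)[OF Z(1)]) (fact * **)+
  qed
  moreover have "card Z \<le> 1" if e1: "e = 1" and ub: "u = 1 \<or> b = 1" and ev: "even (u + e + b)"
  proof -
    have "Z \<subseteq> {(0, 0)}"
    proof clarify
      fix i i' assume iZ: "(i, i') \<in> Z"
      have eq: "(b + 1) * (u - i + 1) = (u + 1) * (b - i' + 1)" using Z(3)[OF iZ] e1 by simp
      have le: "i \<le> u" "i' \<le> b" using iZ Z(1) by auto
      show "i = 0 \<and> i' = 0"
        using ub
      proof
        assume "u = 1"
        then have "i = 0 \<or> i = 1" "even b" using le ev e1 by auto
        then show ?thesis
        proof (elim disjE)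
          assume "i = 1"
          then have "b + 1 = 2 * (b - i' + 1)" using eq \<open>u = 1\<close> by simp
          then have "even (b + 1)" by (metis dvd_triv_left)
          then show ?thesis using \<open>even b\<close> by simp
        qed (use eq \<open>u = 1\<close> le in auto)
      next
        assume "b = 1"
        then have "i' = 0 \<or> i' = 1" "even u" using le ev e1 by auto
        then show ?thesis
        proof (elim disjE)
          assume "i' = 1"
          then have "2 * (u - i + 1) = u + 1" using eq \<open>b = 1\<close> by simp
          then have "even (u + 1)" by (metis dvd_triv_left)
          then show ?thesis using \<open>even u\<close> by simp
        qed (use eq \<open>b = 1\<close> le in auto)
      qed
    qed
    then have "card Z \<le> card {(0::nat, 0::nat)}" by (intro card_mono) auto
    then show ?thesis by simp
  qed
  ultimately show ?thesis using that[of "card Z"] Z(2) by blast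
qed

text \<open>Pure arithmetic on the previous bound. The second outcome is one entry short and ties n
  odd to adjacent positions; the third is the genuinely small one, with the two entries at an
  edge.\<close>

lemma two_nz_cases:
  fixes q :: "'a::field_char_0 poly"
  assumes deg: "degree q < n" and nz: "nz n q = {u, v}" and uv: "u < v"
  shows "3 * n \<le> total_nz n q + 2 \<or>
    (3 * n \<le> total_nz n q + 3 \<and> odd n \<and> v = Suc u \<and> 3 \<le> n) \<or>
    (2 * n \<le> total_nz n q \<and> (u = 0 \<and> v = 1 \<or> u = 0 \<and> v = n \<or> Suc u = n \<and> v = n))"
proof -
  define e b where "e = v - u" and "b = n - v"
  have "v \<le> n" using nz by (auto simp: nz_def set_eq_iff)
  then have n: "n = u + e + b" and v: "v = u + e" and e: "0 < e"
    using uv by (auto simp: e_def b_def)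
  obtain z where z: "e * (u + b + 2) + (u + 1) * (b + 1) \<le> total_nz n q + z"
    "z \<le> u + 1" "z \<le> b + 1" "e = 1 \<Longrightarrow> u = 1 \<or> b = 1 \<Longrightarrow> even n \<Longrightarrow> z \<le> 1"
    using two_nz_total_bound[of q u e b] deg nz e unfolding n v by blast
  define T where "T = total_nz n q"
  have z1: "e * (u + b + 2) + (u + 1) * (b + 1) \<le> T + z" using z(1) by (simp add: T_def)
  consider "u = 0" "b = 0" | "e = 1" "u = 0 \<or> b = 0" | "2 \<le> e" "u = 0" "0 < b" | "2 \<le> e" "b = 0" "0 < u"
    | "0 < u" "0 < b" using e by linarith
  then show ?thesis
  proof cases
    case 1
    then show ?thesis using z1 z n v by (auto simp: T_def)
  next
    case 2
    then show ?thesis using z1 z n v by (auto simp: T_def)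
  next
    case 3
    \<comment> \<open>The count exceeds 3n - 2 by at least (e - 2)(b - 1), as z <= 1 for u = 0; the
      next case is its mirror image.\<close>
    define x y where "x = e - 2" and "y = b - 1"
    have "e = x + 2" "b = y + 1" using \<open>2 \<le> e\<close> \<open>0 < b\<close> by (auto simp: x_def y_def)
    with 3 show ?thesis using z1 z n by (simp add: T_def algebra_simps)
  next
    case 4
    define x y where "x = e - 2" and "y = u - 1"
    have "e = x + 2" "u = y + 1" using \<open>2 \<le> e\<close> \<open>0 < u\<close> by (auto simp: x_def y_def)
    with 4 show ?thesis using z1 z n by (simp add: T_def algebra_simps)
  next
    case 5
    define w x y where "w = e - 1" and "x = u - 1" and "y = b - 1"
    have xyw: "e = w + 1" "b = y + 1" "u = x + 1" using e 5 by (auto simp: w_def x_def y_def)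
    have "w * (x + y + 4) + (x + y + 4) + (x + 2) * (y + 2) \<le> T + z"
      using z1 xyw by (simp add: algebra_simps)
    then have lower: "x * y + w * x + w * y + 4 * w + 3 * x + 3 * y + 8 \<le> T + z"
      by (simp add: algebra_simps)
    have n3: "n = x + y + w + 3" using n xyw by simp
    have zle: "z \<le> x + 2" "z \<le> y + 2" using z xyw by auto
    \<comment> \<open>If x > 0 then y <= x * y; if x = 0 then z <= 2 directly.\<close>
    have zxy: "z \<le> x * y + 2"
    proof (cases x)
      case (Suc m)
      then show ?thesis using zle(2) trans_le_add1[of "y" y "m * y"] by simp
    qed (use zle in simp)
    have ge3: "3 * n \<le> T + 3" using lower zxy n3 by linarith
    show ?thesis
    proof (cases "w = 0 \<and> odd n")
      case True
      then show ?thesis using ge3 v xyw n3 by (simp add: T_def)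
    next
      case False
      \<comment> \<open>Exactly what the bound 3n - 2 requires. For w = 0 the evenness of n excludes
        x = y = 1, where n = 5, and limits z to 1 when x or y vanishes.\<close>
      have "z \<le> x * y + 1 + w"
      proof (cases "w = 0")
        case True
        with False have ev: "even n" by simp
        consider "x = 0 \<or> y = 0" | "x = 1" "y = 1" | "2 \<le> x" "0 < y" | "2 \<le> y" "0 < x" by linarith
        then show ?thesis
        proof cases
          case 1
          then show ?thesis using z(4) xyw True ev by auto
        next
          case 2
          then show ?thesis using ev n3 True by simp
        next
          case 3
          then have "2 * y \<le> x * y" by simp
          then show ?thesis using zle 3 by linarith
        next
          case 4
          then have "x * 2 \<le> x * y" by simp
          then show ?thesis using zle 4 by linarith
        qed
      next
        case False
        then show ?thesis using zxy by linarith
      qed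
      then have "3 * n \<le> T + 2" using lower n3 by linarith
      then show ?thesis by (simp add: T_def)
    qed
  qed
qed

section \<open>Rows with exactly three nonzero values\<close>

lemma card_3_sorted:
  fixes S :: "nat set"
  assumes "card S = 3"
  obtains a b c where "a < b" "b < c" "S = {a, b, c}"
proof -
  obtain x y z where "S = {x, y, z}" "x \<noteq> y" "x \<noteq> z" "y \<noteq> z"
    using assms by (auto simp: card_3_iff)
  then have "\<exists>a b c. a < b \<and> b < c \<and> S = {a, b, c}"
    by (cases x y rule: linorder_cases; cases x z rule: linorder_cases; cases y z rule: linorder_cases)
       (auto intro: exI[of _ x] exI[of _ y] exI[of _ z] simp: insert_commute)
  then show ?thesis using that by blast
qed

lemma card_2_sorted:
  fixes S :: "nat set"
  assumes "card S = 2"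
  obtains a b where "a < b" "S = {a, b}"
proof -
  obtain x y where "S = {x, y}" "x \<noteq> y" using assms by (auto simp: card_2_iff)
  then show ?thesis using that[of x y] that[of y x] by (cases x y rule: linorder_cases) auto
qed

lemma four_le_card_nz:
  assumes "{a, b, c, d} \<subseteq> nz n q" "a < b" "b < c" "c < d"
  shows "4 \<le> card (nz n q)"
  using card_mono[OF finite_nz assms(1)] assms(2-) by simp

text \<open>Since \<open>p\<close> vanishes at both ends, the next row is nonzero just before the
  first and at the last of the three positions. A gap between the positions, or three values with no
  two neighbours equal, would add two more nonzero differences.\<close>

lemma three_nz_rows:
  fixes p :: "'a::field_char_0 poly"
  assumes 3: "card (nz d p) = 3" and ends: "poly p 0 = 0" "poly p (of_nat d) = 0"
    and le: "card (nz (d - 1) (fd p)) \<le> 3"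
  obtains a where "nz d p = {a, a + 1, a + 2}" "0 < a" "a + 3 \<le> d"
    "poly p (of_nat a) = poly p (of_nat (a + 1)) \<or> poly p (of_nat (a + 1)) = poly p (of_nat (a + 2))"
    "a - 1 \<in> nz (d - 1) (fd p)" "a + 2 \<in> nz (d - 1) (fd p)"
proof -
  obtain a b c where abc: "a < b" "b < c" and nz: "nz d p = {a, b, c}"
    using card_3_sorted[OF 3] by blast
  define g where "g i = poly p (of_nat i)" for i :: nat
  have g0: "i \<notin> {a, b, c} \<Longrightarrow> i \<le> d \<Longrightarrow> g i = 0" for i
    using nz_iff[of i d p] nz by (auto simp: g_def)
  have gn: "g a \<noteq> 0" "g b \<noteq> 0" "g c \<noteq> 0" "c \<le> d"
    using nz_iff[of a d p] nz_iff[of b d p] nz_iff[of c d p] nz by (auto simp: g_def)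
  have bd: "0 < a" "c < d"
    using gn ends by (auto simp: g_def intro: gr0I le_neq_implies_less)
  define M where "M = nz (d - 1) (fd p)"
  have r1: "i \<in> M \<longleftrightarrow> i < d \<and> g (Suc i) \<noteq> g i" for i
    using bd by (auto simp: M_def nz_iff poly_fd g_def add.commute)
  have m1: "a - 1 \<in> M" "c \<in> M"
  proof -
    have "g (a - 1) = 0" "g (Suc c) = 0" using abc bd by (auto intro!: g0)
    then show "a - 1 \<in> M" "c \<in> M" using abc bd gn by (auto simp: r1)
  qed
  have b: "b = a + 1"
  proof (rule ccontr)
    assume "b \<noteq> a + 1"
    with abc have "a < b - 1" by simp
    then have "{a - 1, a, b - 1, c} \<subseteq> M"
    proof -
      have "g (Suc a) = 0" "g (b - 1) = 0" using abc bd \<open>a < b - 1\<close> by (auto intro!: g0)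
      then show ?thesis using abc bd gn m1 by (auto simp: r1)
    qed
    then show False using four_le_card_nz[of "a - 1" a "b - 1" c "d - 1" "fd p", folded M_def] le[folded M_def] abc bd \<open>a < b - 1\<close> by fastforce
  qed
  have c: "c = a + 2"
  proof (rule ccontr)
    assume "c \<noteq> a + 2"
    with abc b have "b < c - 1" by simp
    then have "{a - 1, b, c - 1, c} \<subseteq> M"
    proof -
      have "g (Suc b) = 0" "g (c - 1) = 0" using abc bd \<open>b < c - 1\<close> by (auto intro!: g0)
      then show ?thesis using abc bd gn m1 by (auto simp: r1)
    qed
    then show False using four_le_card_nz[of "a - 1" b "c - 1" c "d - 1" "fd p", folded M_def] le[folded M_def] abc bd \<open>b < c - 1\<close> by fastforce
  qed
  have "g a = g (a + 1) \<or> g (a + 1) = g (a + 2)"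
  proof (rule ccontr)
    assume "\<not> ?thesis"
    then have "{a - 1, a, a + 1, a + 2} \<subseteq> M"
      using m1 c bd by (auto simp: r1)
    then show False using four_le_card_nz[of "a - 1" a "a + 1" "a + 2" "d - 1" "fd p", folded M_def] le[folded M_def] bd by fastforce
  qed
  then show ?thesis
    using that[of a] nz b c bd m1 by (simp add: g_def M_def)
qed

text \<open>After division by d the two equations are quadratics with roots 4, 5 and 2, 4
  respectively; hence the bound 6.\<close>

lemma choose_quadratic_ne:
  assumes "6 \<le> d"
  shows "2 * d + (d choose 3) \<noteq> 2 * (d choose 2)" "2 * (d choose 3) + d \<noteq> 2 * (d choose 2)"
proof -
  obtain k where d: "d = k + 6" using assms le_Suc_ex by (metis add.commute)
  have c2: "2 * (d choose 2) = (k + 6) * (k + 5)"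
    using Suc_times_binomial[of 1 "k + 5"] by (simp add: d numeral_2_eq_2 add.commute)
  have c2': "2 * (k + 5 choose 2) = (k + 5) * (k + 4)"
    using Suc_times_binomial[of 1 "k + 4"] by (simp add: numeral_2_eq_2 add.commute)
  have "3 * (d choose 3) = (k + 6) * (k + 5 choose 2)"
    using Suc_times_binomial[of 2 "k + 5"] by (simp add: d numeral_3_eq_3 numeral_2_eq_2 add.commute)
  then have "2 * (3 * (d choose 3)) = (k + 6) * (2 * (k + 5 choose 2))" by simp
  then have c3: "6 * (d choose 3) = (k + 6) * ((k + 5) * (k + 4))"
    unfolding c2' by simp
  show "2 * d + (d choose 3) \<noteq> 2 * (d choose 2)"
  proof
    assume "2 * d + (d choose 3) = 2 * (d choose 2)"
    then have "12 * d + (k + 6) * ((k + 5) * (k + 4)) = 6 * ((k + 6) * (k + 5))"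
      using c2 c3 by linarith
    then have "(k + 6) * (12 + (k + 5) * (k + 4)) = (k + 6) * (6 * (k + 5))"
      unfolding d by (simp add: algebra_simps)
    then have "12 + (k + 5) * (k + 4) = 6 * (k + 5)" by (subst (asm) mult_left_cancel) auto
    then show False by (simp add: algebra_simps)
  qed
  show "2 * (d choose 3) + d \<noteq> 2 * (d choose 2)"
  proof
    assume "2 * (d choose 3) + d = 2 * (d choose 2)"
    then have "2 * ((k + 6) * ((k + 5) * (k + 4))) + 6 * d = 6 * ((k + 6) * (k + 5))"
      using c2 c3 by linarith
    then have "(k + 6) * (2 * ((k + 5) * (k + 4)) + 6) = (k + 6) * (6 * (k + 5))"
      unfolding d by (simp add: algebra_simps)
    then have "2 * ((k + 5) * (k + 4)) + 6 = 6 * (k + 5)" by (subst (asm) mult_left_cancel) auto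
    then show False by (simp add: algebra_simps)
  qed
qed

text \<open>The second row leaves three consecutive values with two neighbours equal. The third row
  forces them next to an end of the row and proportional to (1, 2, 2) or (2, 2, 1). The alternating
  binomial sum then contradicts \<open>choose_quadratic_ne\<close>.\<close>

lemma no_three_trinomial_rows:
  fixes p :: "'a::field_char_0 poly"
  assumes deg: "degree p < d" and ends: "poly p 0 = 0" "poly p (of_nat d) = 0" and d: "6 \<le> d"
    and c: "card (nz d p) = 3" "card (nz (d - 1) (fd p)) = 3" "card (nz (d - 2) (fd (fd p))) \<le> 3"
  shows False
proof -
  obtain a where nz: "nz d p = {a, a + 1, a + 2}" and a: "0 < a" "a + 3 \<le> d"
    and or: "poly p (of_nat a) = poly p (of_nat (a + 1)) \<or> poly p (of_nat (a + 1)) = poly p (of_nat (a + 2))"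
    using three_nz_rows[OF c(1) ends] c(2) by (metis order_refl)
  define g where "g i = poly p (of_nat i)" for i :: nat
  define M N where "M = nz (d - 1) (fd p)" and "N = nz (d - 2) (fd (fd p))"
  have g0: "i \<notin> {a, a + 1, a + 2} \<Longrightarrow> i \<le> d \<Longrightarrow> g i = 0" for i
    using nz_iff[of i d p] nz by (auto simp: g_def)
  have "g i \<noteq> 0" if "i \<in> nz d p" for i
    using that by (simp add: nz_iff g_def)
  then have gn: "g a \<noteq> 0" "g (a + 1) \<noteq> 0" "g (a + 2) \<noteq> 0"
    unfolding nz by blast+
  have r1: "i \<in> M \<longleftrightarrow> i < d \<and> g (Suc i) \<noteq> g i" for i
    using d by (auto simp: M_def nz_iff poly_fd g_def add.commute)
  have r2: "i \<in> N \<longleftrightarrow> i + 2 \<le> d \<and> g (i + 2) - 2 * g (i + 1) + g i \<noteq> 0" for i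
    using d by (auto simp: N_def nz_iff poly_fd g_def algebra_simps)
  have four: "\<not> ({w, x, y, z} \<subseteq> N \<and> w < x \<and> x < y \<and> y < z)" for w x y z
    using four_le_card_nz[of w x y z "d - 2" "fd (fd p)"] c(3) by (auto simp: N_def)
  \<comment> \<open>Otherwise all three values coincide and the second row has only two nonzero
    entries.\<close>
  have ne: "g a \<noteq> g (a + 2)"
  proof
    assume eq: "g a = g (a + 2)"
    have "M \<subseteq> {a - 1, a + 2}"
    proof
      fix i assume "i \<in> M"
      then have i: "i < d" "g (Suc i) \<noteq> g i" by (auto simp: r1)
      then have "i \<in> {a - 1, a, a + 1, a + 2}"
        using g0[of i] g0[of "Suc i"] by fastforce
      then show "i \<in> {a - 1, a + 2}" using i eq or by (auto simp: g_def add.commute)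
    qed
    then have "card M \<le> card {a - 1, a + 2}" by (intro card_mono) auto
    then show False using c(2) a by (simp add: M_def)
  qed
  have z: "g (a - 1) = 0" "g (a + 3) = 0" "2 \<le> a \<Longrightarrow> g (a - 2) = 0" "a + 4 \<le> d \<Longrightarrow> g (a + 4) = 0"
    using a by (auto intro!: g0)
  have low: "a - 2 \<in> N" if "2 \<le> a"
    using that z a gn by (simp add: r2 Suc_diff_Suc numeral_2_eq_2)
  have high: "a + 2 \<in> N" if "a + 4 \<le> d"
    using that z gn by (simp add: r2 eval_nat_numeral)
  have r_1: "a - 1 \<in> N \<longleftrightarrow> g (a + 1) \<noteq> 2 * g a"
    using a z by (simp add: r2)
  have r_0: "a \<in> N \<longleftrightarrow> g (a + 2) - 2 * g (a + 1) + g a \<noteq> 0"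
    using a by (simp add: r2)
  have r_2: "a + 1 \<in> N \<longleftrightarrow> g (a + 1) \<noteq> 2 * g (a + 2)"
    using a z by (simp add: r2 numeral_3_eq_3)
  have "a \<in> N"
  proof -
    have "g (a + 2) - 2 * g (a + 1) + g a = g (a + 2) - g a \<or> g (a + 2) - 2 * g (a + 1) + g a = g a - g (a + 2)"
      using or by (auto simp: g_def)
    then show ?thesis using ne unfolding r_0 by auto
  qed
  have og: "g a = g (a + 1) \<or> g (a + 1) = g (a + 2)"
    using or by (simp only: g_def)
  have sides: "a - 1 \<in> N \<or> a + 1 \<in> N"
    using og gn unfolding r_1 r_2 by (metis mult_2 add_cancel_left_right)
  have "\<not> (2 \<le> a \<and> a + 4 \<le> d)"
  proof
    assume le: "2 \<le> a \<and> a + 4 \<le> d"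
    from sides show False
    proof
      assume "a - 1 \<in> N"
      then have "{a - 2, a - 1, a, a + 2} \<subseteq> N" using le \<open>a \<in> N\<close> low high by simp
      moreover have "a - 2 < a - 1" "a - 1 < a" using le by linarith+
      ultimately show False using four[of "a - 2" "a - 1" a "a + 2"] by simp
    next
      assume "a + 1 \<in> N"
      then have "{a - 2, a, a + 1, a + 2} \<subseteq> N" using le \<open>a \<in> N\<close> low high by simp
      moreover have "a - 2 < a" using le by linarith
      ultimately show False using four[of "a - 2" a "a + 1" "a + 2"] by simp
    qed
  qed
  then have a': "a = 1 \<or> a + 3 = d" using a by linarith
  have "\<not> (a - 1 \<in> N \<and> a + 1 \<in> N)"
  proof
    assume both: "a - 1 \<in> N \<and> a + 1 \<in> N"
    from a' show False
    proof
      assume "a = 1"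
      then have "{a - 1, a, a + 1, a + 2} \<subseteq> N" using both \<open>a \<in> N\<close> high d by simp
      then show False using four[of "a - 1" a "a + 1" "a + 2"] a by simp
    next
      assume "a + 3 = d"
      then have "{a - 2, a - 1, a, a + 1} \<subseteq> N" using both \<open>a \<in> N\<close> low d by simp
      moreover have "a - 2 < a - 1" "a - 1 < a" using \<open>a + 3 = d\<close> d by linarith+
      ultimately show False using four[of "a - 2" "a - 1" a "a + 1"] by simp
    qed
  qed
  \<comment> \<open>At most one of the outer positions \<open>a - 1\<close> and \<open>a + 1\<close>
    is nonzero in the third row, so one of the doubling relations holds; it leaves only one choice
    for the equal neighbours.\<close>
  then have rel: "g (a + 1) = 2 * g a \<and> g (a + 1) = g (a + 2) \<or> g (a + 1) = 2 * g (a + 2) \<and> g (a + 1) = g a"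
  proof -
    have "g (a + 1) \<noteq> 2 * g a \<or> g a \<noteq> g (a + 1)" "g (a + 1) \<noteq> 2 * g (a + 2) \<or> g (a + 1) \<noteq> g (a + 2)"
      using gn by (metis mult_2 add_cancel_left_right)+
    moreover have "g (a + 1) = 2 * g a \<or> g (a + 1) = 2 * g (a + 2)"
      using calculation \<open>\<not> (a - 1 \<in> N \<and> a + 1 \<in> N)\<close> unfolding r_1 r_2 by blast
    ultimately show ?thesis using og by metis
  qed
  have "0 = (\<Sum>u\<le>d. of_nat (d choose u) * ((-1) ^ u * g u))"
    using alternating_sum_zero[OF deg] by (simp add: g_def)
  also have "\<dots> = (\<Sum>u\<in>{a, a + 1, a + 2}. of_nat (d choose u) * ((-1) ^ u * g u))"
    using a g0 by (intro sum.mono_neutral_right) auto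
  also have "\<dots> = (-1) ^ a * (of_nat (d choose a) * g a - of_nat (d choose (a + 1)) * g (a + 1)
      + of_nat (d choose (a + 2)) * g (a + 2))"
    by (simp add: algebra_simps)
  finally have "of_nat (d choose a) * g a - of_nat (d choose (a + 1)) * g (a + 1)
      + of_nat (d choose (a + 2)) * g (a + 2) = 0"
    by (simp only: mult_eq_0_iff power_eq_0_iff neg_equal_0_iff_equal one_neq_zero simp_thms eq_commute[of 0])
  then have sum: "of_nat (d choose a) * g a + of_nat (d choose (a + 2)) * g (a + 2)
      = of_nat (d choose (a + 1)) * g (a + 1)"
    by (simp add: algebra_simps)
  have nat_eq: "(d choose a) + 2 * (d choose (a + 2)) = 2 * (d choose (a + 1)) \<or>
      2 * (d choose a) + (d choose (a + 2)) = 2 * (d choose (a + 1))"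
    using rel
  proof (elim disjE conjE)
    assume e: "g (a + 1) = 2 * g a" "g (a + 1) = g (a + 2)"
    have e2: "g (a + 2) = 2 * g a" using e by simp
    then have "g a * of_nat ((d choose a) + 2 * (d choose (a + 2))) = g a * of_nat (2 * (d choose (a + 1)))"
      using sum unfolding e(1) e2 by (simp add: algebra_simps)
    then show ?thesis using gn(1) unfolding mult_cancel_left of_nat_eq_iff by blast
  next
    assume e: "g (a + 1) = 2 * g (a + 2)" "g (a + 1) = g a"
    have e2: "g a = 2 * g (a + 2)" using e by simp
    then have "g (a + 2) * of_nat (2 * (d choose a) + (d choose (a + 2))) = g (a + 2) * of_nat (2 * (d choose (a + 1)))"
      using sum unfolding e(1) e2 by (simp add: algebra_simps)
    then show ?thesis using gn(3) unfolding mult_cancel_left of_nat_eq_iff by blast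
  qed
  from a' show False
  proof
    assume "a = 1"
    then show False using nat_eq choose_quadratic_ne[OF d] by (simp add: numeral_3_eq_3 numeral_2_eq_2)
  next
    assume "a + 3 = d"
    then have "d choose a = d choose 3" "d choose (a + 1) = d choose 2" "d choose (a + 2) = d choose 1"
      using binomial_symmetric[of a d] binomial_symmetric[of "a + 1" d] binomial_symmetric[of "a + 2" d] by auto
    then show False using nat_eq choose_quadratic_ne[OF d] by simp
  qed
qed

section \<open>The number of nonzero entries of the difference triangle\<close>

text \<open>The falling factorial \<open>(x - t)(x - t - 1)\<cdots>(x - t - m + 1)\<close>.\<close>

definition ff :: "nat \<Rightarrow> nat \<Rightarrow> 'a::field_char_0 poly" where
  "ff t m = (\<Prod>i<m. [:- of_nat (t + i), 1:])"

lemma poly_ff: "poly (ff t m) x = (\<Prod>i<m. x - of_nat (t + i))"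
  by (simp add: ff_def poly_prod algebra_simps)

lemma fd_ff: "fd (ff t (Suc m)) = smult (of_nat (Suc m)) (ff t m)"
proof -
  have "poly (fd (ff t (Suc m))) x = poly (smult (of_nat (Suc m)) (ff t m)) x" for x :: 'a
  proof -
    have 1: "poly (ff t (Suc m)) (x + 1) = (x + 1 - of_nat t) * poly (ff t m) x"
      unfolding poly_ff by (subst prod.lessThan_Suc_shift) (simp add: algebra_simps)
    have 2: "poly (ff t (Suc m)) x = (x - of_nat (t + m)) * poly (ff t m) x"
      by (simp add: poly_ff)
    show ?thesis by (simp add: poly_fd 1 2) (simp add: algebra_simps)
  qed
  then show ?thesis by (simp add: poly_eq_poly_eq_iff[symmetric] fun_eq_iff)
qed

text \<open>The start \<open>t\<close> survives differencing, so the runs of zeros in all rows begin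
  at the same index.\<close>

lemma fd_pow_ff: "k \<le> m \<Longrightarrow> \<exists>c. (fd ^^ k) (ff t m) = smult c (ff t (m - k) :: 'a::field_char_0 poly)"
proof (induction k)
  case 0
  show ?case by (rule exI[of _ 1]) simp
next
  case (Suc k)
  then obtain c where "(fd ^^ k) (ff t m) = smult c (ff t (m - k) :: 'a poly)" by auto
  moreover have "m - k = Suc (m - Suc k)" using Suc.prems by simp
  ultimately show ?case by (auto simp: fd_smult fd_ff)
qed

lemma ff_root: "t \<le> i \<Longrightarrow> i < t + m \<Longrightarrow> poly (ff t m) (of_nat i) = 0"
  unfolding poly_ff by (rule prod_zero[OF finite_lessThan bexI[of _ "i - t"]]) auto

lemma degree_ff: "degree (ff t m :: 'a::field_char_0 poly) = m"
  and lead_coeff_ff: "lead_coeff (ff t m :: 'a::field_char_0 poly) = 1"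
proof -
  have "degree (ff t m :: 'a poly) = (\<Sum>i<m. degree [:- of_nat (t + i), 1 :: 'a:])"
    unfolding ff_def by (rule degree_prod_eq_sum_degree) auto
  then show "degree (ff t m :: 'a poly) = m" by simp
  show "lead_coeff (ff t m :: 'a poly) = 1" by (simp add: ff_def lead_coeff_prod)
qed

text \<open>If the \<open>K\<close>-th difference vanishes at as many consecutive integers as its degree, then \<open>p\<close> is a falling
  factorial up to a correction of degree less than \<open>K\<close>; in the rows above, the falling factorial vanishes on
  a long run, where the few roots of the correction leave many nonzero entries.\<close>

lemma row_run_decomp:
  fixes p :: "'a::field_char_0 poly"
  assumes deg: "degree p = K + m" and zero: "\<And>i. t \<le> i \<Longrightarrow> i < t + m \<Longrightarrow> poly ((fd ^^ K) p) (of_nat i) = 0"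
  obtains c r where "p = smult c (ff t (K + m)) + r" "r = 0 \<or> degree r < K"
proof -
  define c where "c = lead_coeff p"
  define r where "r = p - smult c (ff t (K + m))"
  have p: "p = smult c (ff t (K + m)) + r" by (simp add: r_def)
  \<comment> \<open>The leading terms cancel in \<open>r\<close>, so its K-th difference would have
    degree below m, yet it vanishes at m consecutive integers.\<close>
  have rK: "(fd ^^ K) r = 0"
  proof (rule ccontr)
    assume ne: "(fd ^^ K) r \<noteq> 0"
    obtain c' where c': "(fd ^^ K) (ff t (K + m) :: 'a poly) = smult c' (ff t m)"
      using fd_pow_ff[of K "K + m" t] by auto
    have "(fd ^^ K) p = smult (c * c') (ff t m) + (fd ^^ K) r"
      by (subst p) (simp add: fd_pow_add fd_pow_smult c')
    then have "poly ((fd ^^ K) r) (of_nat i) = 0" if "t \<le> i" "i < t + m" for i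
      using zero[OF that] ff_root[OF that, where 'a = 'a] by simp
    then have E: "{i \<in> {t..<t + m}. poly ((fd ^^ K) r) (of_nat i) \<noteq> 0} = {}" by auto
    have le: "m \<le> degree r - K"
      using card_nonroots[OF ne, of "{t..<t + m}"] unfolding E degree_fd_pow by simp
    have "K \<le> degree r" using ne fd_pow_zero[of r K] by linarith
    then have ge: "K + m \<le> degree r" using le by simp
    have "degree r \<le> K + m"
      unfolding r_def by (rule degree_diff_le) (auto simp: deg degree_ff degree_smult_le[THEN order_trans])
    with ge have "degree r = K + m" by simp
    moreover have "coeff r (K + m) = 0"
      using lead_coeff_ff[of t "K + m", where 'a = 'a] by (simp add: r_def c_def deg degree_ff)
    ultimately have "r = 0" using leading_coeff_0_iff[of r] by simp
    then show False using ne by simp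
  qed
  have "r = 0 \<or> degree r < K"
    using fd_pow_nonzero[of r K] rK by linarith
  with p show ?thesis using that by blast
qed

text \<open>On the run of length k' + 1 + m - k in row k, \<open>p\<close> agrees with a correction
  whose k-th difference has degree at most k' - k; this leaves m + 1 nonzero entries. The correction
  survives because otherwise row k' would have at most two nonzero entries, against
  \<open>three\<close>. The bound \<open>t <= 2\<close> keeps the run inside the row.\<close>

lemma rows_above_run:
  fixes p :: "'a::field_char_0 poly"
  assumes deg: "degree p = Suc k' + m" and t: "t \<le> 2"
    and zero: "\<And>i. t \<le> i \<Longrightarrow> i < t + m \<Longrightarrow> poly ((fd ^^ Suc k') p) (of_nat i) = 0"
    and three: "3 \<le> card (nz (Suc (Suc m)) ((fd ^^ k') p))"
    and k: "k \<le> k'"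
  shows "Suc m \<le> card (nz (Suc (Suc k') + m - k) ((fd ^^ k) p))"
proof -
  obtain c r where p: "p = smult c (ff t (Suc k' + m)) + r" and r: "r = 0 \<or> degree r < Suc k'"
    using row_run_decomp[OF deg zero] by blast
  have rows: "poly ((fd ^^ j) p) (of_nat i) = poly ((fd ^^ j) r) (of_nat i)"
    if ij: "j \<le> k'" "t \<le> i" "i < t + (Suc k' + m - j)" for i j
  proof -
    obtain c' where c': "(fd ^^ j) (ff t (Suc k' + m) :: 'a poly) = smult c' (ff t (Suc k' + m - j))"
      using fd_pow_ff[of j "Suc k' + m" t] ij(1) by auto
    have "(fd ^^ j) p = smult (c * c') (ff t (Suc k' + m - j)) + (fd ^^ j) r"
      by (subst p) (simp only: fd_pow_add fd_pow_smult c' smult_smult)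
    then show ?thesis using ff_root[OF ij(2,3), where 'a = 'a] by simp
  qed
  have ne: "(fd ^^ k') r \<noteq> 0"
  proof
    assume "(fd ^^ k') r = 0"
    then have "nz (Suc (Suc m)) ((fd ^^ k') p) \<subseteq> {..Suc (Suc m)} - {t..<t + Suc m}"
      using rows[of k'] by (auto simp: nz_iff)
    then have "card (nz (Suc (Suc m)) ((fd ^^ k') p)) \<le> card ({..Suc (Suc m)} - {t..<t + Suc m})"
      by (intro card_mono) auto
    also have "\<dots> = 2" using t by (subst card_Diff_subset) auto
    finally show False using three by simp
  qed
  then have ne': "(fd ^^ k) r \<noteq> 0"
    using k by (metis fd_pow_0 funpow_add le_add_diff_inverse2 o_apply)
  let ?A = "{t..<t + (Suc k' + m - k)}"
  have "card ?A \<le> card {i \<in> ?A. poly ((fd ^^ k) r) (of_nat i) \<noteq> 0} + degree ((fd ^^ k) r)"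
    by (rule card_nonroots[OF ne']) simp
  also have "{i \<in> ?A. poly ((fd ^^ k) r) (of_nat i) \<noteq> 0} \<subseteq> nz (Suc (Suc k') + m - k) ((fd ^^ k) p)"
    using rows[OF k] t k by (auto simp: nz_iff)
  then have "card {i \<in> ?A. poly ((fd ^^ k) r) (of_nat i) \<noteq> 0} \<le> card (nz (Suc (Suc k') + m - k) ((fd ^^ k) p))"
    by (intro card_mono) auto
  finally show ?thesis using r k ne' by (auto simp: degree_fd_pow)
qed

section \<open>Summing the rows, by the degree of the polynomial\<close>

lemma sum_ge_const:
  fixes f :: "nat \<Rightarrow> nat"
  assumes "\<And>k. k < K \<Longrightarrow> c \<le> f k"
  shows "K * c \<le> (\<Sum>k<K. f k)"
  using sum_bounded_below[of "{..<K}" c f] assms by simp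

lemma sum_ge_const_strict:
  fixes f :: "nat \<Rightarrow> nat"
  assumes "\<And>k. k < K \<Longrightarrow> c \<le> f k" "j < K" "c < f j"
  shows "K * c < (\<Sum>k<K. f k)"
proof -
  have "(\<Sum>k<K. c) < (\<Sum>k<K. f k)"
    using assms by (intro sum_strict_mono_ex1) auto
  then show ?thesis by simp
qed

text \<open>Supplies the one additional entry that even d demands.\<close>

lemma first_rows_extra:
  fixes p :: "'a::field_char_0 poly"
  assumes "degree p < d" "poly p 0 = 0" "poly p (of_nat d) = 0" "6 \<le> d" "3 \<le> K"
    and ge: "\<And>k. k < K \<Longrightarrow> 3 \<le> card (nz (d - k) ((fd ^^ k) p))"
  shows "3 * K + 1 \<le> (\<Sum>k<K. card (nz (d - k) ((fd ^^ k) p)))"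
proof -
  have "\<exists>j<3. 3 < card (nz (d - j) ((fd ^^ j) p))"
  proof (rule ccontr)
    assume "\<not> ?thesis"
    then have "card (nz (d - j) ((fd ^^ j) p)) = 3" if "j < 3" for j
      using ge[of j] \<open>3 \<le> K\<close> that by (metis le_antisym not_less order_less_le_trans)
    from this[of 0] this[of 1] this[of 2] show False
      using no_three_trinomial_rows[of p d] assms(1-4) by (simp add: numeral_2_eq_2)
  qed
  then obtain j where "j < K" "3 < card (nz (d - j) ((fd ^^ j) p))"
    using \<open>3 \<le> K\<close> order_less_le_trans by blast
  then show ?thesis
    using sum_ge_const_strict[of K 3 "\<lambda>k. card (nz (d - k) ((fd ^^ k) p))" j] ge by simp
qed

text \<open>Three rows have at least d - 1 nonzero entries each. Here \<open>p\<close> is a multiple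
  of x(x - d), and its first difference vanishes only where 2i + 1 = d, so for even d the middle row
  has no zero at all.\<close>

lemma degree_two_total:
  fixes p :: "'a::field_char_0 poly"
  assumes e: "degree p = 2" and ends: "poly p 0 = 0" "poly p (of_nat d) = 0" and d: "3 \<le> d"
  shows "3 * d \<le> total_nz d p + (if odd d then 3 else 2)"
proof -
  have p0: "p \<noteq> 0" using e by auto
  have row: "d - k + 1 \<le> card (nz (d - k) ((fd ^^ k) p)) + (2 - k)" if "k \<le> 2" for k
    using card_nz_ge[OF fd_pow_nonzero[OF p0], of k "d - k"] that by (simp add: e degree_fd_pow)
  have "total_nz d p \<ge> (\<Sum>k<3. card (nz (d - k) ((fd ^^ k) p)))"
    using total_nz_split[of 3 d p] d by simp
  then have tot: "card (nz d p) + card (nz (d - 1) (fd p)) + card (nz (d - 2) (fd (fd p))) \<le> total_nz d p"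
    by (simp add: numeral_3_eq_3 numeral_2_eq_2)
  show ?thesis
  proof (cases "odd d")
    case True
    then show ?thesis using tot row[of 0] row[of 1] row[of 2] d by (simp add: numeral_2_eq_2)
  next
    case False
    obtain c0 p1 where p1: "p = pCons c0 p1" by (cases p)
    then have "degree p1 = 1" using e by (auto split: if_splits)
    moreover obtain c1 p2 where p2: "p1 = pCons c1 p2" by (cases p1)
    ultimately have "degree p2 = 0" by (auto split: if_splits)
    then obtain c2 where "p2 = [:c2:]" by (rule degree_eq_zeroE)
    then have p: "p = [:c0, c1, c2:]" using p1 p2 by simp
    have "c0 = 0" using ends(1) by (simp add: p)
    moreover have "(c1 + c2 * of_nat d) * of_nat d = 0"
      using ends(2) \<open>c0 = 0\<close> by (simp add: p algebra_simps)
    ultimately have c: "c0 = 0" "c1 = - c2 * of_nat d" using d by (auto simp: eq_neg_iff_add_eq_0)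
    have "c2 \<noteq> 0" using e p by (auto split: if_splits)
    have "poly (fd p) (of_nat i) \<noteq> 0" for i
    proof
      assume "poly (fd p) (of_nat i) = 0"
      then have "c2 * (of_nat (2 * i + 1) - of_nat d) = 0"
        by (simp add: poly_fd p c algebra_simps)
      then have "(of_nat (2 * i + 1) :: 'a) = of_nat d" using \<open>c2 \<noteq> 0\<close> by simp
      then have "2 * i + 1 = d" using of_nat_eq_iff by blast
      then show False using False by auto
    qed
    then have "nz (d - 1) (fd p) = {..d - 1}" by (auto simp: nz_iff)
    then show ?thesis using tot row[of 0] row[of 2] d False by (simp add: numeral_2_eq_2)
  qed
qed

text \<open>Root counting suffices except for degree d - 2 with d even, where it yields exactly 3d -
  3 and \<open>first_rows_extra\<close> adds one.\<close>

lemma middle_degree_total: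
  fixes p :: "'a::field_char_0 poly"
  assumes e: "3 \<le> degree p" "degree p + 2 \<le> d" and ends: "poly p 0 = 0" "poly p (of_nat d) = 0"
  shows "3 * d \<le> total_nz d p + (if odd d then 3 else 2)"
proof -
  have p0: "p \<noteq> 0" using e by auto
  define m where "m = d - degree p + 1"
  have row: "m \<le> card (nz (d - k) ((fd ^^ k) p))" if "k < Suc (degree p)" for k
    using card_nz_ge[OF fd_pow_nonzero[OF p0], of k "d - k"] that e by (simp add: degree_fd_pow m_def)
  have tot: "(\<Sum>k<Suc (degree p). card (nz (d - k) ((fd ^^ k) p))) \<le> total_nz d p"
    using total_nz_split[of "Suc (degree p)" d p] e by linarith
  have low: "Suc (degree p) * m \<le> total_nz d p"
    using sum_ge_const[OF row] tot by (rule order_trans)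
  show ?thesis
  proof (cases "degree p + 2 = d")
    case True
    then have m: "m = 3" by (simp add: m_def)
    show ?thesis
    proof (cases "odd d")
      case True
      then show ?thesis using low m \<open>degree p + 2 = d\<close> by simp
    next
      case False
      have "d \<noteq> 5" using False by auto
      then have "3 * Suc (degree p) + 1 \<le> (\<Sum>k<Suc (degree p). card (nz (d - k) ((fd ^^ k) p)))"
        using row m e ends \<open>degree p + 2 = d\<close> by (intro first_rows_extra) auto
      then show ?thesis using tot \<open>degree p + 2 = d\<close> False by simp
    qed
  next
    case False
    \<comment> \<open>The count (x + 4)(y + 4) exceeds 3d - 2 = 3x + 3y + 16 by at least x + y + x
      y.\<close>
    define x y where "x = degree p - 3" and "y = d - degree p - 3"
    have xy: "degree p = x + 3" "d = x + y + 6" using False e by (simp_all add: x_def y_def)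
    then have "m = y + 4" by (simp add: m_def)
    then have "(x + 4) * (y + 4) \<le> total_nz d p" using low xy by (simp add: algebra_simps)
    then show ?thesis using xy(2) by (simp add: algebra_simps split: if_splits)
  qed
qed

text \<open>Rows above the first two-entry row have at least three nonzero entries, so only the
  second and third outcomes of \<open>two_nz_cases\<close> need extra entries from above.\<close>

lemma top_degree_total:
  fixes p :: "'a::field_char_0 poly"
  assumes e: "Suc (degree p) = d" and p0: "p \<noteq> 0" and ends: "poly p 0 = 0" "poly p (of_nat d) = 0"
  shows "3 * d \<le> total_nz d p + (if odd d then 3 else 2)"
proof -
  define row where "row k = card (nz (d - k) ((fd ^^ k) p))" for k
  have row2: "2 \<le> row k" if "k < d" for k
    using card_nz_ge[OF fd_pow_nonzero[OF p0], of k "d - k"] that e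
    by (simp add: degree_fd_pow row_def)
  define K where "K = (LEAST k. k < d \<and> row k = 2)"
  \<comment> \<open>That row has only two positions, so a row with exactly two nonzero entries
    exists.\<close>
  have "row (d - 1) \<le> 2"
  proof -
    have "nz 1 ((fd ^^ (d - 1)) p) \<subseteq> {0, 1}" by (auto simp: nz_iff)
    then have "card (nz 1 ((fd ^^ (d - 1)) p)) \<le> card {0::nat, 1}" by (intro card_mono) auto
    then show ?thesis using e by (simp add: row_def)
  qed
  then have "d - 1 < d \<and> row (d - 1) = 2" using row2[of "d - 1"] e by simp
  then have K: "K < d" "row K = 2" unfolding K_def by (metis (mono_tags, lifting) LeastI)+
  have row3: "3 \<le> row k" if "k < K" for k
    using row2[of k] not_less_Least[of k "\<lambda>k. k < d \<and> row k = 2"] that K unfolding K_def[symmetric]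
    by fastforce
  define n q where "n = d - K" and "q = (fd ^^ K) p"
  have d: "d = K + n" "0 < n" using K by (auto simp: n_def)
  have degq: "degree q < n" using e K(1) unfolding q_def degree_fd_pow n_def by linarith
  have "card (nz n q) = 2" using K(2) by (simp add: row_def n_def q_def)
  then obtain u v where uv: "u < v" and nzq: "nz n q = {u, v}" by (rule card_2_sorted)
  have tot: "total_nz d p = (\<Sum>k<K. row k) + total_nz n q"
    using total_nz_split[of K d p] K by (simp add: row_def n_def q_def)
  have sum3: "K * 3 \<le> (\<Sum>k<K. row k)" using row3 by (rule sum_ge_const)
  have extra: "3 * K + 1 \<le> (\<Sum>k<K. row k)" if "6 \<le> d" "3 \<le> K"
    unfolding row_def
    by (rule first_rows_extra) (use e ends that row3 in \<open>simp_all add: row_def\<close>)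
  consider "3 * n \<le> total_nz n q + 2" | "3 * n \<le> total_nz n q + 3" "odd n" "v = Suc u" "3 \<le> n"
    | "2 * n \<le> total_nz n q" "u = 0 \<and> v = 1 \<or> u = 0 \<and> v = n \<or> Suc u = n \<and> v = n"
    using two_nz_cases[OF degq nzq uv] by blast
  then show ?thesis
  proof cases
    case 1
    then show ?thesis using tot sum3 d by simp
  next
    case 2
    show ?thesis
    proof (cases "odd d")
      case True
      then show ?thesis using 2 tot sum3 d by simp
    next
      case False
      then have "odd K" using 2 d by simp
      then have "K \<noteq> 0" "K \<noteq> 2" by presburger+
      then consider "K = 1" | "3 \<le> K" by linarith
      then have "3 * K + 1 \<le> (\<Sum>k<K. row k)"
      proof cases
        case 1
        \<comment> \<open>Three nonzero entries in the top row would put nonzero entries at distance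
          three in the next one, whose only two are adjacent.\<close>
        have "row 0 \<noteq> 3"
        proof
          assume "row 0 = 3"
          moreover have nz1: "nz (d - 1) (fd p) = {u, v}"
            using nzq 1 by (simp add: n_def q_def)
          moreover have "card {u, v} \<le> 3" by (simp add: card_insert_if)
          ultimately obtain a where "a - 1 \<in> {u, v}" "a + 2 \<in> {u, v}" "0 < a"
            using three_nz_rows[of d p] ends by (auto simp: row_def)
          then show False using 2 by auto
        qed
        then show ?thesis using row3[of 0] 1 by simp
      next
        case _: 2
        then show ?thesis using extra 2 d by simp
      qed
      then show ?thesis using tot 2 d False by simp
    qed
  next
    case 3
    \<comment> \<open>First index of the run of n - 1 zeros: between the two entries, after both, or
      before both.\<close>
    define t where "t = (if u = 0 \<and> v = n then 1 else if u = 0 \<and> v = 1 then 2 else 0 :: nat)"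
    have zero: "poly q (of_nat i) = 0" if "t \<le> i" "i < t + (n - 1)" for i
    proof -
      have "i \<notin> {u, v}" "i \<le> n" using 3(2) that uv by (auto simp: t_def split: if_splits)
      then show ?thesis using nzq by (auto simp: nz_def)
    qed
    have "K \<noteq> 0"
    proof
      assume "K = 0"
      then have "nz d p = {u, v}" "n = d" using nzq by (simp_all add: n_def q_def)
      moreover have "0 \<notin> nz d p" "d \<notin> nz d p" using ends by (simp_all add: nz_iff)
      ultimately have "0 \<notin> {u, v}" "n \<notin> {u, v}" by simp_all
      then show False using 3(2) by blast
    qed
    then obtain k' where k': "K = Suc k'" using not0_implies_Suc by blast
    have rown: "n \<le> row k" if "k < K" for k
    proof -
      have "Suc (n - 1) \<le> card (nz (Suc (Suc k') + (n - 1) - k) ((fd ^^ k) p))"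
      proof (rule rows_above_run[where t = t])
        show "degree p = Suc k' + (n - 1)" using e d k' by simp
        show "t \<le> 2" by (simp add: t_def)
        show "poly ((fd ^^ Suc k') p) (of_nat i) = 0" if "t \<le> i" "i < t + (n - 1)" for i
          using zero[OF that] unfolding q_def k' .
        show "3 \<le> card (nz (Suc (Suc (n - 1))) ((fd ^^ k') p))"
          using row3[of k'] k' d by (simp add: row_def)
        show "k \<le> k'" using that k' by simp
      qed
      then show ?thesis using d k' by (simp add: row_def)
    qed
    have sumn: "K * n \<le> (\<Sum>k<K. row k)" using rown by (rule sum_ge_const)
    show ?thesis
    proof (cases "n \<le> 2")
      case True
      then show ?thesis using 3 tot sum3 d by simp
    next
      case False
      define x where "x = n - 3"
      have x: "n = x + 3" using False by (simp add: x_def)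
      \<comment> \<open>Equivalent to a surplus of x k' = (n - 3)(K - 1) over 3d - 3; for even d
        only K = 1 and n = 3 remain critical.\<close>
      have nonlin: "3 * K + x * K + 2 * x + 6 \<le> total_nz d p"
        using sumn 3(1) tot x by (simp add: algebra_simps)
      have xk: "x * K = x + x * k'" by (simp add: k')
      show ?thesis
      proof (cases "odd d")
        case True
        then show ?thesis using nonlin xk d x by simp
      next
        case even: False
        \<comment> \<open>For K = 1 the correction is a constant b. The zeros of \<open>p\<close> at
          both ends force b = 0, but then the top row has at most two nonzero entries.\<close>
        have "k' \<noteq> 0"
        proof
          assume "k' = 0"
          then have K1: "K = 1" and dn: "d = Suc n" using k' d by auto
          have "degree p = K + (n - 1)" using e d by simp
          then obtain c r where p: "p = smult c (ff t (K + (n - 1))) + r" and r: "r = 0 \<or> degree r < K"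
            using row_run_decomp[of p K "n - 1" t] zero unfolding q_def by blast
          obtain b where b: "r = [:b:]" using r K1 by (metis degree_eq_zeroE less_one pCons_0_0)
          have pn: "p = smult c (ff t n) + [:b:]" using p K1 b d by simp
          have "c \<noteq> 0" using ends(1) p0 by (auto simp: pn)
          have "b \<noteq> 0"
          proof
            assume "b = 0"
            then have "nz d p \<subseteq> {..d} - {t..<t + n}"
              using ff_root[of t _ n, where 'a = 'a] by (auto simp: nz_iff pn)
            then have "card (nz d p) \<le> card ({..d} - {t..<t + n})" by (intro card_mono) auto
            also have "\<dots> = 2" using dn by (subst card_Diff_subset) (auto simp: t_def)
            finally show False using row3[of 0] K1 by (simp add: row_def)
          qed
          consider "t = 0" | "t = 1" | "t = 2" unfolding t_def by presburger
          then show False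
          proof cases
            case 1
            then have "poly (ff t n) (0 :: 'a) = 0" using ff_root[of t 0 n, where 'a = 'a] d by simp
            then show False using ends(1) \<open>b \<noteq> 0\<close> by (simp add: pn)
          next
            case 2
            \<comment> \<open>The roots 1, ..., n are symmetric about d / 2 and n is odd, so the
              values at 0 and d are opposite; adding the two end conditions gives 2b = 0.\<close>
            define P where "P = (\<Prod>i<n. of_nat (Suc i) :: 'a)"
            have "P \<noteq> 0" unfolding P_def by (simp del: of_nat_Suc)
            have "poly (ff 1 n) (0 :: 'a) = (\<Prod>i<n. - of_nat (Suc i))"
              unfolding poly_ff by (intro prod.cong) auto
            also have "\<dots> = (-1) ^ n * P" by (simp only: P_def prod_uminus card_lessThan)
            finally have P0: "poly (ff 1 n) (0 :: 'a) = - P" using even dn by simp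
            have "poly (ff 1 n) (of_nat d :: 'a) = (\<Prod>i<n. of_nat (Suc (n - Suc i)))"
              unfolding poly_ff dn by (intro prod.cong refl) (auto simp: of_nat_diff)
            also have "\<dots> = P" unfolding P_def by (rule prod.nat_diff_reindex)
            finally have Pd: "poly (ff 1 n) (of_nat d :: 'a) = P" .
            have "poly p x = c * poly (ff 1 n) x + b" for x
              using 2 by (simp add: pn)
            from this[of 0] this[of "of_nat d"] have "c * - P + b = 0" "c * P + b = 0"
              unfolding P0 Pd ends by simp_all
            moreover have "2 * b = (c * - P + b) + (c * P + b)" by (simp add: algebra_simps)
            ultimately have "2 * b = 0" by (simp only: add_0)
            then show False using \<open>b \<noteq> 0\<close> by simp
          next
            case 3
            then have "poly (ff t n) (of_nat d :: 'a) = 0"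
              using ff_root[of t d n, where 'a = 'a] dn \<open>\<not> n \<le> 2\<close> by simp
            then show False using ends(2) \<open>b \<noteq> 0\<close> by (simp add: pn)
          qed
        qed
        show ?thesis
        proof (cases "x = 0")
          case True
          have "K \<noteq> 2" "d \<noteq> 5" using even d x True by auto
          then have "3 \<le> K" "6 \<le> d" using k' \<open>k' \<noteq> 0\<close> d x by auto
          then show ?thesis using extra tot 3 d x True even by simp
        next
          case False
          then have "0 < x * k'" using \<open>k' \<noteq> 0\<close> by simp
          then have "3 * d \<le> total_nz d p + 2" using nonlin xk d(1) x by linarith
          then show ?thesis using even by simp
        qed
      qed
    qed
  qed
qed

text \<open>The distinct roots 0 and d force degree at least two, so the three degree ranges are
  exhaustive.\<close>

theorem total_nz_lower_bound:
  fixes p :: "'a::field_char_0 poly"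
  assumes "p \<noteq> 0" "degree p < d" "poly p 0 = 0" "poly p (of_nat d) = 0"
  shows "3 * d \<le> total_nz d p + (if odd d then 3 else 2)"
proof -
  have E: "{i \<in> {0, d}. poly p (of_nat i) \<noteq> 0} = {}" using assms(3,4) by auto (metis of_nat_0 neq0_conv)
  have "2 \<le> degree p"
    using card_nonroots[OF assms(1), of "{0, d}"] assms(2) unfolding E by simp
  then consider "degree p = 2" "3 \<le> d" | "3 \<le> degree p" "degree p + 2 \<le> d" | "Suc (degree p) = d"
    using assms(2) by linarith
  then show ?thesis
    using degree_two_total middle_degree_total top_degree_total assms by cases blast+
qed

section \<open>Monomial ideals and their quotients\<close>

abbreviation xpow :: "(3 \<Rightarrow>\<^sub>0 nat) \<Rightarrow> 'k::field poly3" where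
  "xpow m \<equiv> Poly_Mapping.single m 1"

abbreviation const :: "'k \<Rightarrow> 'k::field poly3" where
  "const c \<equiv> Poly_Mapping.single 0 c"

definition exponents :: "'k::field poly3 set \<Rightarrow> (3 \<Rightarrow>\<^sub>0 nat) set" where
  "exponents I = {m. xpow m \<in> I}"

definition supported :: "(3 \<Rightarrow>\<^sub>0 nat) set \<Rightarrow> 'k::field poly3 set" where
  "supported A = {f. Poly_Mapping.keys f \<subseteq> A}"

lemma poly3_ring_simps [simp]:
  "carrier poly3_ring = UNIV" "x \<otimes>\<^bsub>poly3_ring\<^esub> y = x * y" "x \<oplus>\<^bsub>poly3_ring\<^esub> y = x + y"
  "\<one>\<^bsub>poly3_ring\<^esub> = 1" "\<zero>\<^bsub>poly3_ring\<^esub> = 0"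
  by (simp_all add: ring_of_type_algebra_def)

lemma ring_poly3: "ring (poly3_ring :: 'k::field poly3 ring)"
  by (rule ring_from_type_algebra)

lemma supported_iff: "f \<in> supported A \<longleftrightarrow> Poly_Mapping.keys f \<subseteq> A"
  by (simp add: supported_def)

lemma homogeneous_part_supported: "homogeneous_part j = supported {m. mon_degree m = j}"
  by (auto simp: homogeneous_part_def supported_def)

lemma supported_0 [simp]: "0 \<in> supported A"
  by (simp add: supported_iff)

lemma supported_add: "f \<in> supported A \<Longrightarrow> g \<in> supported A \<Longrightarrow> f + g \<in> supported A"
  using keys_add[of f g] by (auto simp: supported_iff)

lemma supported_uminus: "f \<in> supported A \<Longrightarrow> - f \<in> supported A"
  by (auto simp: supported_iff in_keys_iff)

lemma supported_diff: "f \<in> supported A \<Longrightarrow> g \<in> supported A \<Longrightarrow> f - g \<in> supported A"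
  using supported_add[of f A "- g"] supported_uminus[of g A] by simp

lemma supported_sum: "(\<And>x. x \<in> S \<Longrightarrow> f x \<in> supported A) \<Longrightarrow> sum f S \<in> supported A"
  by (induction S rule: infinite_finite_induct) (auto intro: supported_add)

lemma supported_single: "m \<in> A \<Longrightarrow> Poly_Mapping.single m c \<in> supported A"
  by (simp add: supported_iff)

lemma supported_mult:
  assumes "f \<in> supported A" "g \<in> supported B" "\<And>m n. m \<in> A \<Longrightarrow> n \<in> B \<Longrightarrow> m + n \<in> C"
  shows "f * g \<in> supported C"
  using keys_mult[of f g] assms by (fastforce simp: supported_iff)

lemma single_eq_const_mult: "Poly_Mapping.single m c = const c * xpow m"
  by (simp add: mult_single)

lemma poly_mapping_expand:
  assumes "finite A" "Poly_Mapping.keys f \<subseteq> A"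
  shows "f = (\<Sum>m\<in>A. Poly_Mapping.single m (Poly_Mapping.lookup f m))"
proof (rule poly_mapping_eqI)
  fix k
  have "(\<Sum>m\<in>A. Poly_Mapping.lookup (Poly_Mapping.single m (Poly_Mapping.lookup f m)) k)
     = (\<Sum>m\<in>A. if m = k then Poly_Mapping.lookup f m else 0)"
    by (intro sum.cong refl) (auto simp: lookup_single when_def)
  also have "\<dots> = Poly_Mapping.lookup f k"
    using assms by (auto simp: sum.delta in_keys_iff)
  finally show "Poly_Mapping.lookup f k
      = Poly_Mapping.lookup (\<Sum>m\<in>A. Poly_Mapping.single m (Poly_Mapping.lookup f m)) k"
    by (simp add: lookup_sum)
qed

lemma lookup_const_mult: "Poly_Mapping.lookup (const c * f) m = c * Poly_Mapping.lookup f m"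
  by (simp add: mult_map_scale_conv_mult[symmetric] Poly_Mapping.map.rep_eq when_def)

lemma supported_const_mult: "f \<in> supported A \<Longrightarrow> const c * f \<in> supported A"
  by (auto simp: supported_iff in_keys_iff lookup_const_mult)

lemma poly3_idealI:
  fixes I :: "'k::field poly3 set"
  assumes "0 \<in> I" "\<And>f g. f \<in> I \<Longrightarrow> g \<in> I \<Longrightarrow> f + g \<in> I" "\<And>f g. f \<in> I \<Longrightarrow> g * f \<in> I"
  shows "ideal I poly3_ring"
proof (rule idealI[OF ring_poly3])
  interpret R: ring "poly3_ring :: 'k poly3 ring" by (rule ring_poly3)
  have "- f \<in> I" if "f \<in> I" for f using assms(3)[OF that, of "- 1"] by simp
  moreover have "\<ominus>\<^bsub>poly3_ring\<^esub> f = - f" for f :: "'k poly3"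
    by (rule R.minus_equality) auto
  ultimately show "subgroup I (add_monoid poly3_ring)"
    using assms by (intro R.add.subgroupI) (auto simp: a_inv_def)
qed (use assms in \<open>auto simp: mult.commute\<close>)

context
  fixes I :: "'k::field poly3 set"
  assumes I: "ideal I poly3_ring"
begin

interpretation ideal I poly3_ring by (rule I)

lemma ideal_0: "0 \<in> I"
  using additive_subgroup.zero_closed[OF is_additive_subgroup] by simp

lemma ideal_add: "f \<in> I \<Longrightarrow> g \<in> I \<Longrightarrow> f + g \<in> I"
  using additive_subgroup.a_closed[OF is_additive_subgroup] by simp

lemma ideal_mult: "f \<in> I \<Longrightarrow> g * f \<in> I"
  using I_l_closed by simp

lemma ideal_uminus: "f \<in> I \<Longrightarrow> - f \<in> I"
  using ideal_mult[of f "- 1"] by simp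

lemma ideal_diff: "f \<in> I \<Longrightarrow> g \<in> I \<Longrightarrow> f - g \<in> I"
  using ideal_add[of f "- g"] ideal_uminus[of g] by simp

lemma ideal_sum: "(\<And>x. x \<in> S \<Longrightarrow> f x \<in> I) \<Longrightarrow> sum f S \<in> I"
  by (induction S rule: infinite_finite_induct) (auto intro: ideal_add ideal_0)

lemma coset_iff: "g \<in> I +>\<^bsub>poly3_ring\<^esub> f \<longleftrightarrow> g - f \<in> I"
  by (force simp: a_r_coset_def')

lemma coset_eq_iff: "I +>\<^bsub>poly3_ring\<^esub> f = I +>\<^bsub>poly3_ring\<^esub> g \<longleftrightarrow> f - g \<in> I"
proof
  assume "I +>\<^bsub>poly3_ring\<^esub> f = I +>\<^bsub>poly3_ring\<^esub> g"
  moreover have "f \<in> I +>\<^bsub>poly3_ring\<^esub> f" by (simp add: coset_iff ideal_0)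
  ultimately show "f - g \<in> I" by (simp add: coset_iff)
next
  assume fg: "f - g \<in> I"
  show "I +>\<^bsub>poly3_ring\<^esub> f = I +>\<^bsub>poly3_ring\<^esub> g"
    using ideal_add[OF _ fg] ideal_diff[OF _ fg] by (fastforce simp: coset_iff)
qed

lemma quot_mult: "(I +>\<^bsub>poly3_ring\<^esub> f) \<otimes>\<^bsub>poly3_ring Quot I\<^esub> (I +>\<^bsub>poly3_ring\<^esub> g) = I +>\<^bsub>poly3_ring\<^esub> (f * g)"
  using rcoset_mult_add[of f g] by (simp add: FactRing_def)

lemma quot_add: "(I +>\<^bsub>poly3_ring\<^esub> f) \<oplus>\<^bsub>poly3_ring Quot I\<^esub> (I +>\<^bsub>poly3_ring\<^esub> g) = I +>\<^bsub>poly3_ring\<^esub> (f + g)"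
  using a_rcos_sum[of f g] by (simp add: FactRing_def)

lemma quot_zero: "\<zero>\<^bsub>poly3_ring Quot I\<^esub> = I +>\<^bsub>poly3_ring\<^esub> 0"
proof -
  have "I +>\<^bsub>poly3_ring\<^esub> 0 = I" by (auto simp: coset_iff)
  then show ?thesis by (simp add: FactRing_def)
qed

lemma quot_one: "\<one>\<^bsub>poly3_ring Quot I\<^esub> = I +>\<^bsub>poly3_ring\<^esub> 1"
  by (simp add: FactRing_def)

lemma quot_carrier: "carrier (poly3_ring Quot I) = range (\<lambda>f. I +>\<^bsub>poly3_ring\<^esub> f)"
  by (auto simp: FactRing_def A_RCOSETS_defs a_r_coset_defs)

lemma quot_ring: "ring (poly3_ring Quot I)"
  by (rule quotient_is_ring)

lemma subfield_quot_scalars: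
  assumes "1 \<notin> I"
  shows "subfield (quot_scalars I) (poly3_ring Quot I)"
proof -
  interpret Q: ring "poly3_ring Quot I" by (rule quot_ring)
  let ?F = "ring_of_type_algebra :: 'k ring"
  interpret F: Ring.field ?F by (rule field_from_type_algebra)
  have "(\<lambda>c. I +>\<^bsub>poly3_ring\<^esub> const c) \<in> ring_hom ?F (poly3_ring Quot I)"
    by (rule ring_hom_memI)
       (simp_all add: quot_mult quot_add quot_carrier quot_one mult_single single_add
          ring_of_type_algebra_def[where 'a = 'k])
  then interpret ring_hom_ring ?F "poly3_ring Quot I" "\<lambda>c. I +>\<^bsub>poly3_ring\<^esub> const c"
    by (intro ring_hom_ringI2 F.ring_axioms Q.ring_axioms)
  have "\<one>\<^bsub>poly3_ring Quot I\<^esub> \<noteq> \<zero>\<^bsub>poly3_ring Quot I\<^esub>"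
    using assms by (simp add: quot_zero quot_one coset_eq_iff)
  from img_is_subfield(2)[OF F.carrier_is_subfield this]
  show ?thesis by (simp add: quot_scalars_def ring_of_type_algebra_def[where 'a = 'k])
qed

end

text \<open>The polynomials supported on the monomials of \<open>I\<close> already form an ideal
  containing the generators, so \<open>I\<close> is spanned by its monomials.\<close>

lemma monomial_ideal_eq_supported:
  fixes I :: "'k::field poly3 set"
  assumes "monomial_ideal I"
  shows "ideal I poly3_ring" "I = supported (exponents I)"
    "\<And>m n. m \<in> exponents I \<Longrightarrow> n + m \<in> exponents I"
proof -
  interpret R: ring "poly3_ring :: 'k poly3 ring" by (rule ring_poly3)
  obtain M where M: "M \<subseteq> monomials" "I = Idl\<^bsub>poly3_ring\<^esub> M"
    using assms by (auto simp: monomial_ideal_def)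
  show id: "ideal I poly3_ring" unfolding M(2) by (rule R.genideal_ideal) simp
  show closed: "n + m \<in> exponents I" if "m \<in> exponents I" for m n
    using ideal_mult[OF id, of "xpow m" "xpow n"] that by (simp add: exponents_def mult_single)
  have "ideal (supported (exponents I)) (poly3_ring :: 'k poly3 ring)"
  proof (rule poly3_idealI)
    fix f g :: "'k poly3" assume "f \<in> supported (exponents I)"
    then show "g * f \<in> supported (exponents I)"
      using closed by (intro supported_mult[of g UNIV]) (auto simp: supported_iff)
  qed (auto intro: supported_add)
  moreover have "M \<subseteq> supported (exponents I)"
    using M(1) R.genideal_self[of M] by (force simp: monomials_def supported_iff exponents_def M(2))
  ultimately have "I \<subseteq> supported (exponents I)"
    unfolding M(2) by (rule R.genideal_minimal)
  moreover have "f \<in> I" if "f \<in> supported (exponents I)" for f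
  proof -
    have "const (Poly_Mapping.lookup f m) * xpow m \<in> I" if "m \<in> Poly_Mapping.keys f" for m
      using that \<open>f \<in> _\<close> by (intro ideal_mult[OF id]) (auto simp: supported_iff exponents_def)
    then show ?thesis
      by (subst poly_mapping_expand[of "Poly_Mapping.keys f" f])
         (auto intro!: ideal_sum[OF id] simp: mult_single)
  qed
  ultimately show "I = supported (exponents I)" by auto
qed

text \<open>The degree-d generators need not be monomials, but all their terms lie in
  \<open>I\<close>. The span of the multiples of degree-d monomials of \<open>I\<close> is an ideal
  containing them.\<close>

lemma generated_exponents:
  fixes I :: "'k::field poly3 set"
  assumes "monomial_ideal I" "generated_in_degree d I" "m \<in> exponents I"
  obtains a b where "a \<in> exponents I" "mon_degree a = d" "m = b + a"
proof -
  interpret R: ring "poly3_ring :: 'k poly3 ring" by (rule ring_poly3)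
  obtain G where G: "G \<subseteq> homogeneous_part d" "I = Idl\<^bsub>poly3_ring\<^esub> G"
    using assms(2) by (auto simp: generated_in_degree_def)
  note mono = monomial_ideal_eq_supported[OF assms(1)]
  define D where "D = {b + a | a b. a \<in> exponents I \<and> mon_degree a = d}"
  have "ideal (supported D) (poly3_ring :: 'k poly3 ring)"
  proof (rule poly3_idealI)
    fix f g :: "'k poly3" assume "f \<in> supported D"
    then show "g * f \<in> supported D"
      by (intro supported_mult[of g UNIV]) (auto simp: supported_iff D_def, metis add.assoc)
  qed (auto intro: supported_add)
  moreover have "G \<subseteq> supported D"
  proof
    fix g assume "g \<in> G"
    then have "g \<in> homogeneous_part d" and "g \<in> I" using G R.genideal_self[of G] by auto
    moreover have "g \<in> supported (exponents I)"
      by (subst mono(2)[symmetric]) (rule \<open>g \<in> I\<close>)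
    ultimately have "Poly_Mapping.keys g \<subseteq> exponents I" "\<forall>m\<in>Poly_Mapping.keys g. mon_degree m = d"
      by (simp_all add: supported_iff homogeneous_part_def)
    then show "g \<in> supported D" unfolding supported_iff D_def by force
  qed
  ultimately have "I \<subseteq> supported D" unfolding G(2) by (rule R.genideal_minimal)
  moreover have "xpow m \<in> I" using assms(3) by (simp add: exponents_def)
  ultimately have "m \<in> D" by (auto simp: supported_iff)
  then show ?thesis using that by (auto simp: D_def)
qed

section \<open>Exponent vectors in coordinates; the Hilbert function as a count of standard
  monomials\<close>

definition expo :: "nat \<Rightarrow> nat \<Rightarrow> nat \<Rightarrow> 3 \<Rightarrow>\<^sub>0 nat" where
  "expo i j k = Poly_Mapping.single 0 i + Poly_Mapping.single 1 j + Poly_Mapping.single 2 k"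

lemma UNIV_3: "(UNIV :: 3 set) = {0, 1, 2}"
  by (rule sym, rule card_subset_eq) auto

lemma lookup_expo [simp]:
  "Poly_Mapping.lookup (expo i j k) 0 = i" "Poly_Mapping.lookup (expo i j k) 1 = j"
  "Poly_Mapping.lookup (expo i j k) 2 = k"
  by (simp_all add: expo_def lookup_add lookup_single)

lemma expo_lookup: "expo (Poly_Mapping.lookup m 0) (Poly_Mapping.lookup m 1) (Poly_Mapping.lookup m 2) = m"
proof (rule poly_mapping_eqI)
  fix i :: 3
  have "i \<in> {0, 1, 2}" using UNIV_3 by auto
  then show "Poly_Mapping.lookup (expo (Poly_Mapping.lookup m 0) (Poly_Mapping.lookup m 1) (Poly_Mapping.lookup m 2)) i
      = Poly_Mapping.lookup m i"
    by auto
qed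

lemma expo_cases: obtains i j k where "m = expo i j k"
  using expo_lookup[of m] by metis

lemma expo_add: "expo i j k + expo i' j' k' = expo (i + i') (j + j') (k + k')"
  by (simp add: expo_def single_add ac_simps)

lemma expo_eq_iff [simp]: "expo i j k = expo i' j' k' \<longleftrightarrow> i = i' \<and> j = j' \<and> k = k'"
  by (metis lookup_expo)

lemma mon_degree_eq:
  "mon_degree m = Poly_Mapping.lookup m 0 + Poly_Mapping.lookup m 1 + Poly_Mapping.lookup m 2"
  unfolding mon_degree_def UNIV_3 by simp

lemma mon_degree_expo [simp]: "mon_degree (expo i j k) = i + j + k"
  by (simp add: mon_degree_eq)

lemma mon_degree_add: "mon_degree (m + n) = mon_degree m + mon_degree n"
  by (simp add: mon_degree_def lookup_add sum.distrib)

lemma mon_degree_eq_image: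
  "{m. mon_degree m = d} = (\<lambda>(i, j, k). expo i j k) ` {(i, j, k). i + j + k = d}"
proof (intro Set.set_eqI iffI)
  fix m assume "m \<in> {m. mon_degree m = d}"
  moreover obtain i j k where "m = expo i j k" by (rule expo_cases)
  ultimately show "m \<in> (\<lambda>(i, j, k). expo i j k) ` {(i, j, k). i + j + k = d}"
    by (auto intro!: image_eqI[of _ _ "(i, j, k)"])
qed auto

lemma finite_mon_degree [simp]: "finite {m. mon_degree m = d}"
proof -
  have "finite {(i, j, k). i + j + k = d}"
    by (rule finite_subset[of _ "{..d} \<times> {..d} \<times> {..d}"]) auto
  then show ?thesis unfolding mon_degree_eq_image by (rule finite_imageI)
qed

lemma card_exponents_of_degree:
  "card {m. mon_degree m = d \<and> P m} = card {(i, j, k). i + j + k = d \<and> P (expo i j k)}"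
proof (rule bij_betw_same_card[symmetric])
  show "bij_betw (\<lambda>(i, j, k). expo i j k) {(i, j, k). i + j + k = d \<and> P (expo i j k)} {m. mon_degree m = d \<and> P m}"
  proof (rule bij_betwI[where g = "\<lambda>m. (Poly_Mapping.lookup m 0, Poly_Mapping.lookup m 1, Poly_Mapping.lookup m 2)"])
    show "(\<lambda>m. (Poly_Mapping.lookup m 0, Poly_Mapping.lookup m 1, Poly_Mapping.lookup m 2))
      \<in> {m. mon_degree m = d \<and> P m} \<rightarrow> {(i, j, k). i + j + k = d \<and> P (expo i j k)}"
      by (auto simp: expo_lookup mon_degree_eq)
  qed (auto simp: expo_lookup)
qed

text \<open>Each new monomial outside \<open>I\<close> is a genuine line extension: an element of
  \<open>I\<close> has no term outside \<open>exponents I\<close>, so no relation modulo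
  \<open>I\<close> can involve it.\<close>

lemma dimension_quot_supported:
  fixes I :: "'k::field poly3 set"
  assumes I: "monomial_ideal I" "1 \<notin> I" and A: "finite A" "A \<inter> exponents I = {}"
  shows "ring.dimension (poly3_ring Quot I) (card A) (quot_scalars I) ((\<lambda>f. I +>\<^bsub>poly3_ring\<^esub> f) ` supported A)"
  using A
proof (induction A rule: finite_induct)
  case empty
  note id = monomial_ideal_eq_supported(1)[OF I(1)]
  interpret Q: ring "poly3_ring Quot I" by (rule quot_ring[OF id])
  have "supported {} = {0 :: 'k poly3}" by (auto simp: supported_def)
  then show ?case using Q.zero_dim[of "quot_scalars I"] by (simp add: quot_zero[OF id])
next
  case (insert m A)
  note mono = monomial_ideal_eq_supported[OF I(1)]
  note id = mono(1)
  interpret Q: ring "poly3_ring Quot I" by (rule quot_ring[OF id])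
  let ?h = "\<lambda>f. I +>\<^bsub>poly3_ring\<^esub> f"
  have new: "?h (xpow m) \<notin> ?h ` supported A"
  proof
    assume "?h (xpow m) \<in> ?h ` supported A"
    then obtain f where f: "f \<in> supported A" "xpow m - f \<in> I"
      by (auto simp: coset_eq_iff[OF id])
    then have "xpow m - f \<in> supported (exponents I)" using mono(2) by blast
    moreover have "Poly_Mapping.lookup f m = 0"
      using f(1) insert.hyps(2) by (auto simp: supported_iff in_keys_iff)
    then have "m \<in> Poly_Mapping.keys (xpow m - f)" by (simp add: in_keys_iff lookup_minus)
    ultimately show False using insert.prems by (auto simp: supported_iff)
  qed
  have "Q.dimension (Suc (card A)) (quot_scalars I) (Q.line_extension (quot_scalars I) (?h (xpow m)) (?h ` supported A))"
    using insert new by (intro Q.Suc_dim) (auto simp: quot_carrier[OF id])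
  moreover have "Q.line_extension (quot_scalars I) (?h (xpow m)) (?h ` supported A) = ?h ` supported (insert m A)"
  proof (intro Set.set_eqI iffI)
    fix u assume "u \<in> Q.line_extension (quot_scalars I) (?h (xpow m)) (?h ` supported A)"
    then obtain c f where "f \<in> supported A" "u = ?h (Poly_Mapping.single m c + f)"
      unfolding Q.line_extension_mem_iff
      by (auto simp: quot_scalars_def quot_mult[OF id] quot_add[OF id] mult_single)
    moreover have "Poly_Mapping.single m c + f \<in> supported (insert m A)"
      using \<open>f \<in> supported A\<close> by (intro supported_add supported_single) (auto simp: supported_iff)
    ultimately show "u \<in> ?h ` supported (insert m A)" by blast
  next
    fix u assume "u \<in> ?h ` supported (insert m A)"
    then obtain f where f: "f \<in> supported (insert m A)" "u = ?h f" by auto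
    define g where "g = f - Poly_Mapping.single m (Poly_Mapping.lookup f m)"
    have "g \<in> supported A"
      using f(1) by (auto simp: g_def supported_iff in_keys_iff lookup_minus lookup_single when_def split: if_splits)
    moreover have "u = ?h (const (Poly_Mapping.lookup f m)) \<otimes>\<^bsub>poly3_ring Quot I\<^esub> ?h (xpow m) \<oplus>\<^bsub>poly3_ring Quot I\<^esub> ?h g"
      by (simp add: f(2) quot_mult[OF id] quot_add[OF id] mult_single g_def)
    ultimately show "u \<in> Q.line_extension (quot_scalars I) (?h (xpow m)) (?h ` supported A)"
      unfolding Q.line_extension_mem_iff quot_scalars_def by blast
  qed
  ultimately show ?case using insert.hyps by simp
qed

lemma reduce_mod_monomial_ideal:
  fixes I :: "'k::field poly3 set"
  assumes I: "monomial_ideal I" and f: "f \<in> supported A"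
  obtains g where "g \<in> supported (A - exponents I)" "f - g \<in> I"
proof -
  define g where "g = (\<Sum>m\<in>Poly_Mapping.keys f - exponents I. Poly_Mapping.single m (Poly_Mapping.lookup f m))"
  define h where "h = (\<Sum>m\<in>Poly_Mapping.keys f \<inter> exponents I. Poly_Mapping.single m (Poly_Mapping.lookup f m))"
  have "f = (\<Sum>m\<in>Poly_Mapping.keys f. Poly_Mapping.single m (Poly_Mapping.lookup f m))"
    by (rule poly_mapping_expand) simp_all
  also have "\<dots> = h + g"
    unfolding g_def h_def by (rule sum.Int_Diff) simp
  finally have "f - g = h" by simp
  moreover have "h \<in> supported (exponents I)"
    unfolding h_def by (intro supported_sum supported_single) auto
  then have "h \<in> I" using monomial_ideal_eq_supported(2)[OF I] by blast
  moreover have "g \<in> supported (A - exponents I)"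
    unfolding g_def using f by (intro supported_sum supported_single) (auto simp: supported_iff)
  ultimately show ?thesis using that by simp
qed

lemma hilbert_function_eq_card:
  fixes I :: "'k::field poly3 set"
  assumes I: "monomial_ideal I" "1 \<notin> I"
  shows "hilbert_function I d = card {m. mon_degree m = d \<and> m \<notin> exponents I}"
proof -
  note id = monomial_ideal_eq_supported(1)[OF I(1)]
  interpret Q: ring "poly3_ring Quot I" by (rule quot_ring[OF id])
  let ?h = "\<lambda>f. I +>\<^bsub>poly3_ring\<^esub> f"
  let ?A = "{m. mon_degree m = d} - exponents I"
  have "quot_part I d = ?h ` supported ?A"
  proof (intro Set.set_eqI iffI)
    fix u assume "u \<in> quot_part I d"
    then obtain f where f: "f \<in> supported {m. mon_degree m = d}" "u = ?h f"
      by (auto simp: quot_part_def homogeneous_part_supported)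
    obtain g where "g \<in> supported ?A" "f - g \<in> I"
      using reduce_mod_monomial_ideal[OF I(1) f(1)] by blast
    then show "u \<in> ?h ` supported ?A"
      unfolding f(2) by (metis coset_eq_iff[OF id] imageI)
  next
    fix u assume "u \<in> ?h ` supported ?A"
    then obtain f where f: "f \<in> supported ?A" "u = ?h f" by blast
    then have "f \<in> supported {m. mon_degree m = d}" by (auto simp: supported_iff)
    with f(2) show "u \<in> quot_part I d"
      unfolding quot_part_def homogeneous_part_supported by blast
  qed
  then have "Q.dimension (card ?A) (quot_scalars I) (quot_part I d)"
    using dimension_quot_supported[OF I, of ?A] by auto
  moreover have "?A = {m. mon_degree m = d \<and> m \<notin> exponents I}" by auto
  ultimately show ?thesis
    using Q.dimI[OF subfield_quot_scalars[OF id I(2)]] by (simp add: hilbert_function_def over_def)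
qed

text \<open>The chain of ideals generated by powers of one variable stabilizes in the quotient, so
  \<open>I\<close> contains x^N - g x^(N + 1) for some N. Its term x^N cannot cancel, and a monomial
  ideal contains every term of its elements.\<close>

lemma pure_power_in_artinian:
  fixes I :: "'k::field poly3 set" and i :: 3
  assumes art: "artinian_ideal I" and I: "monomial_ideal I"
  obtains N where "Poly_Mapping.single i N \<in> exponents I"
proof -
  note mono = monomial_ideal_eq_supported[OF I]
  note id = mono(1)
  interpret R: ring "poly3_ring :: 'k poly3 ring" by (rule ring_poly3)
  let ?h = "\<lambda>f. I +>\<^bsub>poly3_ring\<^esub> f"
  define P where "P n = range (\<lambda>g :: 'k poly3. g * xpow (Poly_Mapping.single i n))" for n
  have "ideal (P n) poly3_ring" for n
  proof (rule poly3_idealI)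
    show "0 \<in> P n" unfolding P_def by (rule range_eqI[of _ _ 0]) simp
    fix f g :: "'k poly3"
    assume f: "f \<in> P n"
    then show "g * f \<in> P n" unfolding P_def by (auto simp: mult.assoc[symmetric])
    show "f + g \<in> P n" if "g \<in> P n"
      using f that unfolding P_def by (auto simp: distrib_right[symmetric])
  qed
  then have qid: "ideal (?h ` P n) (poly3_ring Quot I)" for n
    by (rule R.ring_ideal_imp_quot_ideal[OF id])
  have sub: "P (Suc n) \<subseteq> P n" for n
  proof
    fix f assume "f \<in> P (Suc n)"
    then obtain g where "f = g * xpow (Poly_Mapping.single i (Suc n))" by (auto simp: P_def)
    then have "f = (g * xpow (Poly_Mapping.single i 1)) * xpow (Poly_Mapping.single i n)"
      by (simp add: mult.assoc mult_single single_add[symmetric])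
    then show "f \<in> P n" unfolding P_def by blast
  qed
  have dcc: "(\<forall>n. ideal (J n) (poly3_ring Quot I)) \<and> (\<forall>n. J (Suc n) \<subseteq> J n) \<longrightarrow> (\<exists>N. \<forall>n\<ge>N. J n = J N)" for J
    using art unfolding artinian_ideal_def artinian_ring_def by blast
  have "\<exists>N. \<forall>n\<ge>N. ?h ` P n = ?h ` P N"
    by (rule dcc[THEN mp]) (intro conjI allI qid image_mono sub)
  then obtain N where N: "\<forall>n\<ge>N. ?h ` P n = ?h ` P N" ..
  have "xpow (Poly_Mapping.single i N) \<in> P N"
    unfolding P_def by (rule range_eqI[of _ _ 1]) simp
  then have "?h (xpow (Poly_Mapping.single i N)) \<in> ?h ` P (Suc N)"
    using N by (metis imageI le_SucI order_refl)
  then obtain g where g: "xpow (Poly_Mapping.single i N) - g * xpow (Poly_Mapping.single i (Suc N)) \<in> I"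
    by (auto simp: coset_eq_iff[OF id] P_def)
  let ?f = "xpow (Poly_Mapping.single i N) - g * xpow (Poly_Mapping.single i (Suc N))"
  have "g * xpow (Poly_Mapping.single i (Suc N)) \<in> supported {m. N < Poly_Mapping.lookup m i}"
    by (rule supported_mult[of g UNIV _ "{Poly_Mapping.single i (Suc N)}"])
       (auto simp: supported_iff lookup_add)
  then have "Poly_Mapping.lookup (g * xpow (Poly_Mapping.single i (Suc N))) (Poly_Mapping.single i N) = 0"
    by (auto simp: supported_iff in_keys_iff)
  then have "Poly_Mapping.single i N \<in> Poly_Mapping.keys ?f"
    by (simp add: in_keys_iff lookup_minus)
  moreover have "?f \<in> supported (exponents I)" using g mono(2) by blast
  ultimately show ?thesis using that by (auto simp: supported_iff)
qed

text \<open>A degree-d monomial dividing a power of a variable is the d-th power of that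
  variable.\<close>

lemma generator_pure_power:
  fixes I :: "'k::field poly3 set" and i :: 3
  assumes "artinian_ideal I" "monomial_ideal I" "generated_in_degree d I"
  shows "Poly_Mapping.single i d \<in> exponents I"
proof -
  obtain N where "Poly_Mapping.single i N \<in> exponents I"
    using pure_power_in_artinian assms by blast
  then obtain a b where a: "a \<in> exponents I" "mon_degree a = d" "Poly_Mapping.single i N = b + a"
    using generated_exponents assms by blast
  have z: "Poly_Mapping.lookup a j = 0" if "j \<noteq> i" for j
    using arg_cong[OF a(3), of "\<lambda>m. Poly_Mapping.lookup m j"] that by (simp add: lookup_add lookup_single)
  then have "mon_degree a = (\<Sum>j\<in>{i}. Poly_Mapping.lookup a j)"
    unfolding mon_degree_def by (intro sum.mono_neutral_right) auto
  then have "a = Poly_Mapping.single i d"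
    using a(2) z by (intro poly_mapping_eqI) (auto simp: lookup_single when_def)
  then show ?thesis using a(1) by simp
qed

section \<open>Functionals annihilating the multiples of a linear form\<close>

definition linear_form :: "'k \<Rightarrow> 'k \<Rightarrow> 'k \<Rightarrow> 'k::field poly3" where
  "linear_form a b c = Poly_Mapping.single (expo 1 0 0) a + Poly_Mapping.single (expo 0 1 0) b
     + Poly_Mapping.single (expo 0 0 1) c"

lemma mon_degree_1: "mon_degree m = 1 \<longleftrightarrow> m \<in> {expo 1 0 0, expo 0 1 0, expo 0 0 1}"
proof -
  obtain i j k where "m = expo i j k" by (rule expo_cases)
  then show ?thesis by auto
qed

lemma linear_form_homogeneous: "linear_form a b c \<in> homogeneous_part 1"
  unfolding homogeneous_part_supported linear_form_def
  by (intro supported_add supported_single) auto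

lemma homogeneous_part_1:
  assumes "f \<in> homogeneous_part 1"
  obtains a b c where "f = linear_form a b c"
proof -
  have "Poly_Mapping.keys f \<subseteq> {expo 1 0 0, expo 0 1 0, expo 0 0 1}"
    using assms unfolding homogeneous_part_def mon_degree_1 by blast
  from poly_mapping_expand[OF _ this] show ?thesis
    by (intro that[of "Poly_Mapping.lookup f (expo 1 0 0)" "Poly_Mapping.lookup f (expo 0 1 0)"
        "Poly_Mapping.lookup f (expo 0 0 1)"]) (simp add: linear_form_def add.assoc)
qed

lemma linear_form_mult_homogeneous:
  "g \<in> homogeneous_part j \<Longrightarrow> linear_form a b c * g \<in> homogeneous_part (Suc j)"
  unfolding homogeneous_part_supported
  by (rule supported_mult[OF linear_form_homogeneous[unfolded homogeneous_part_supported]])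
     (auto simp: mon_degree_add)

text \<open>Encodes by its values on monomials a functional on degree \<open>Suc j\<close> that
  kills \<open>I\<close> and all multiples of the linear form: an element of the dual of the
  cokernel.\<close>

definition annihilates :: "'k \<Rightarrow> 'k \<Rightarrow> 'k \<Rightarrow> 'k::field poly3 set \<Rightarrow> nat \<Rightarrow> ((3 \<Rightarrow>\<^sub>0 nat) \<Rightarrow> 'k) \<Rightarrow> bool" where
  "annihilates a b c I j \<phi> \<longleftrightarrow> (\<forall>m\<in>exponents I. mon_degree m = Suc j \<longrightarrow> \<phi> m = 0) \<and>
     (\<forall>m. mon_degree m = j \<longrightarrow>
        a * \<phi> (m + expo 1 0 0) + b * \<phi> (m + expo 0 1 0) + c * \<phi> (m + expo 0 0 1) = 0)"

lemma vector_space_poly3: "vector_space (\<lambda>(c::'k::field) (f::'k poly3). const c * f)"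
  by unfold_locales (simp_all add: distrib_left distrib_right single_add mult_single mult.assoc[symmetric])

lemma (in vector_space) separating_functional:
  assumes "subspace W" "x \<notin> W"
  obtains \<psi> where "Vector_Spaces.linear scale (*) \<psi>" "\<And>w. w \<in> W \<Longrightarrow> \<psi> w = 0" "\<psi> x = 1"
proof -
  interpret pair: vector_space_pair scale "(*)"
    by unfold_locales (simp_all add: algebra_simps)
  obtain B where B: "B \<subseteq> W" "independent B" "W \<subseteq> span B"
    by (rule maximal_independent_subset)
  have "span B \<subseteq> W" using B(1) assms(1) by (rule span_minimal)
  then have "x \<notin> span B" using assms(2) by auto
  then have "independent (insert x B)" using B(2) by (rule independent_insertI)
  then obtain \<psi> where \<psi>: "Vector_Spaces.linear scale (*) \<psi>" "\<forall>y\<in>insert x B. \<psi> y = (if y = x then 1 else 0)"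
    using pair.linear_independent_extend[of "insert x B" "\<lambda>y. if y = x then 1 else 0"] by blast
  have "\<psi> y = 0" if "y \<in> B" for y
    using that \<psi>(2) assms(2) B(1) by auto
  then have "\<psi> w = 0" if "w \<in> W" for w
    using pair.linear_eq_0_on_span[OF \<psi>(1)] that B(3) by blast
  then show ?thesis using that \<psi> by simp
qed

section \<open>Evaluating functionals; duality with the cokernel\<close>

definition pairing :: "nat \<Rightarrow> ((3 \<Rightarrow>\<^sub>0 nat) \<Rightarrow> 'k) \<Rightarrow> 'k::field poly3 \<Rightarrow> 'k" where
  "pairing d \<phi> f = (\<Sum>m | mon_degree m = d. Poly_Mapping.lookup f m * \<phi> m)"

lemma pairing_add: "pairing d \<phi> (f + g) = pairing d \<phi> f + pairing d \<phi> g"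
  by (simp add: pairing_def lookup_add distrib_right sum.distrib)

lemma pairing_const_mult: "pairing d \<phi> (const c * f) = c * pairing d \<phi> f"
  by (simp add: pairing_def lookup_const_mult sum_distrib_left mult.assoc)

lemma pairing_uminus: "pairing d \<phi> (- f) = - pairing d \<phi> f"
  by (simp add: pairing_def sum_negf)

lemma pairing_diff: "pairing d \<phi> (f - g) = pairing d \<phi> f - pairing d \<phi> g"
  using pairing_add[of d \<phi> f "- g"] by (simp add: pairing_uminus)

lemma pairing_0 [simp]: "pairing d \<phi> 0 = 0"
  by (simp add: pairing_def)

lemma pairing_sum: "pairing d \<phi> (\<Sum>x\<in>S. f x) = (\<Sum>x\<in>S. pairing d \<phi> (f x))"
  by (induction S rule: infinite_finite_induct) (auto simp: pairing_add)

lemma pairing_single: "mon_degree m = d \<Longrightarrow> pairing d \<phi> (Poly_Mapping.single m c) = c * \<phi> m"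
proof -
  assume "mon_degree m = d"
  have "pairing d \<phi> (Poly_Mapping.single m c) = (\<Sum>k | mon_degree k = d. if k = m then c * \<phi> m else 0)"
    unfolding pairing_def by (intro sum.cong refl) (auto simp: lookup_single when_def)
  then show ?thesis using \<open>mon_degree m = d\<close> by (simp add: sum.delta)
qed

lemma pairing_linear_form_mult:
  assumes ann: "annihilates a b c I j \<phi>" and g: "g \<in> homogeneous_part j"
  shows "pairing (Suc j) \<phi> (linear_form a b c * g) = 0"
proof -
  let ?S = "{m. mon_degree m = j}"
  let ?g = "Poly_Mapping.lookup g"
  have "g = (\<Sum>m\<in>?S. Poly_Mapping.single m (?g m))"
    using g by (intro poly_mapping_expand) (auto simp: homogeneous_part_def)
  then have "linear_form a b c * g = linear_form a b c * (\<Sum>m\<in>?S. Poly_Mapping.single m (?g m))"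
    by (rule arg_cong)
  also have "\<dots> = (\<Sum>m\<in>?S. linear_form a b c * Poly_Mapping.single m (?g m))"
    by (rule sum_distrib_left)
  finally have "linear_form a b c * g = (\<Sum>m\<in>?S. linear_form a b c * Poly_Mapping.single m (?g m))" .
  moreover have "pairing (Suc j) \<phi> (linear_form a b c * Poly_Mapping.single m (?g m)) = 0" if "m \<in> ?S" for m
  proof -
    have "pairing (Suc j) \<phi> (linear_form a b c * Poly_Mapping.single m (?g m))
      = ?g m * (a * \<phi> (m + expo 1 0 0) + b * \<phi> (m + expo 0 1 0) + c * \<phi> (m + expo 0 0 1))"
      using that
      by (simp add: linear_form_def distrib_right distrib_left mult_single pairing_add pairing_single
          mon_degree_add add.commute[of _ m] mult.commute mult.left_commute)
    then show ?thesis using ann that by (simp add: annihilates_def)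
  qed
  ultimately show ?thesis by (simp add: pairing_sum)
qed

lemma pairing_ideal:
  assumes I: "monomial_ideal I" and ann: "annihilates a b c I j \<phi>" and f: "f \<in> I"
  shows "pairing (Suc j) \<phi> f = 0"
proof -
  have "f \<in> supported (exponents I)"
    using monomial_ideal_eq_supported(2)[OF I] f by blast
  then have "Poly_Mapping.lookup f m * \<phi> m = 0" if "mon_degree m = Suc j" for m
    using ann that by (cases "m \<in> exponents I") (auto simp: annihilates_def supported_iff in_keys_iff)
  then show ?thesis unfolding pairing_def by (simp add: sum.neutral)
qed

text \<open>A form missed by the map lies outside the subspace of all l g + h, with g of degree j
  and h in \<open>I\<close>, and is separated from it by a functional. Conversely such a functional
  vanishes on every preimage relation.\<close>

lemma not_surj_iff:
  fixes I :: "'k::field poly3 set" and a b c :: 'k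
  assumes I: "monomial_ideal I"
  defines "l \<equiv> I +>\<^bsub>poly3_ring\<^esub> linear_form a b c"
  shows "(\<lambda>u. l \<otimes>\<^bsub>poly3_ring Quot I\<^esub> u) ` quot_part I j \<noteq> quot_part I (Suc j)
    \<longleftrightarrow> (\<exists>\<phi> m. annihilates a b c I j \<phi> \<and> mon_degree m = Suc j \<and> \<phi> m \<noteq> 0)"
proof -
  note mono = monomial_ideal_eq_supported[OF I]
  note id = mono(1)
  let ?h = "\<lambda>f. I +>\<^bsub>poly3_ring\<^esub> f"
  let ?l = "linear_form a b c"
  have im: "(\<lambda>u. l \<otimes>\<^bsub>poly3_ring Quot I\<^esub> u) ` quot_part I j = (\<lambda>g. ?h (?l * g)) ` homogeneous_part j"
    by (simp add: quot_part_def image_image l_def quot_mult[OF id])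
  have sub: "(\<lambda>g. ?h (?l * g)) ` homogeneous_part j \<subseteq> quot_part I (Suc j)"
    unfolding quot_part_def using linear_form_mult_homogeneous by blast
  show ?thesis
  proof
    assume "(\<lambda>u. l \<otimes>\<^bsub>poly3_ring Quot I\<^esub> u) ` quot_part I j \<noteq> quot_part I (Suc j)"
    then have "\<not> quot_part I (Suc j) \<subseteq> (\<lambda>g. ?h (?l * g)) ` homogeneous_part j"
      using sub unfolding im by (metis subset_antisym)
    then obtain u where u: "u \<in> quot_part I (Suc j)" "u \<notin> (\<lambda>g. ?h (?l * g)) ` homogeneous_part j"
      unfolding subset_iff by blast
    from u(1) obtain f where "u = ?h f" "f \<in> homogeneous_part (Suc j)"
      unfolding quot_part_def by (rule imageE)
    with u(2) have f: "f \<in> homogeneous_part (Suc j)" "?h f \<notin> (\<lambda>g. ?h (?l * g)) ` homogeneous_part j"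
      by simp_all
    define W where "W = {?l * g + h | g h. g \<in> homogeneous_part j \<and> h \<in> I}"
    interpret P: vector_space "\<lambda>(c::'k) (f::'k poly3). const c * f" by (rule vector_space_poly3)
    have W: "P.subspace W"
    proof (rule P.subspaceI)
      show "0 \<in> W" unfolding W_def using ideal_0[OF id]
        by (auto intro!: exI[of _ 0] simp: homogeneous_part_supported)
      fix x y assume "x \<in> W"
      then obtain g h where x: "x = ?l * g + h" "g \<in> homogeneous_part j" "h \<in> I" by (auto simp: W_def)
      show "x + y \<in> W" if yW: "y \<in> W"
      proof -
        obtain g' h' where y: "y = ?l * g' + h'" "g' \<in> homogeneous_part j" "h' \<in> I"
          using yW by (auto simp: W_def)
        have "x + y = ?l * (g + g') + (h + h')" by (simp add: x y algebra_simps)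
        moreover have "g + g' \<in> homogeneous_part j"
          using x(2) y(2) unfolding homogeneous_part_supported by (rule supported_add)
        ultimately show ?thesis unfolding W_def using ideal_add[OF id x(3) y(3)] by blast
      qed
      fix c :: 'k
      have "const c * x = ?l * (const c * g) + const c * h" by (simp add: x algebra_simps)
      moreover have "const c * g \<in> homogeneous_part j"
        using x(2) by (auto simp: homogeneous_part_def in_keys_iff lookup_const_mult)
      ultimately show "const c * x \<in> W" unfolding W_def using ideal_mult[OF id x(3)] by blast
    qed
    have "f \<notin> W"
    proof
      assume "f \<in> W"
      then obtain g h where "f = ?l * g + h" "g \<in> homogeneous_part j" "h \<in> I" by (auto simp: W_def)
      then have "?h f = ?h (?l * g)" by (simp add: coset_eq_iff[OF id])
      then show False using f(2) \<open>g \<in> homogeneous_part j\<close> by blast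
    qed
    then obtain \<psi> where \<psi>: "Vector_Spaces.linear (\<lambda>(c::'k) (f::'k poly3). const c * f) (*) \<psi>"
      "\<And>w. w \<in> W \<Longrightarrow> \<psi> w = 0" "\<psi> f = 1"
      using P.separating_functional[OF W] by blast
    interpret Vector_Spaces.linear "\<lambda>(c::'k) (f::'k poly3). const c * f" "(*)" \<psi> by (rule \<psi>(1))
    define \<phi> where "\<phi> m = \<psi> (xpow m)" for m
    have single: "\<psi> (Poly_Mapping.single m x) = x * \<phi> m" for m x
      using scale[of x "xpow m"] by (simp add: \<phi>_def mult_single)
    have "annihilates a b c I j \<phi>"
      unfolding annihilates_def
    proof (intro conjI ballI allI impI)
      fix m assume "m \<in> exponents I"
      then have "xpow m \<in> I" by (simp add: exponents_def)
      moreover have "0 \<in> homogeneous_part j" by (simp add: homogeneous_part_supported)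
      ultimately have "?l * 0 + xpow m \<in> W" unfolding W_def by blast
      then have "xpow m \<in> W" by simp
      then show "\<phi> m = 0" using \<psi>(2) by (simp add: \<phi>_def)
    next
      fix m assume m: "mon_degree m = j"
      then have "xpow m \<in> homogeneous_part j"
        unfolding homogeneous_part_supported by (intro supported_single) simp
      then have "?l * xpow m + 0 \<in> W" unfolding W_def using ideal_0[OF id] by blast
      then have "\<psi> (?l * xpow m) = 0" using \<psi>(2) by simp
      then show "a * \<phi> (m + expo 1 0 0) + b * \<phi> (m + expo 0 1 0) + c * \<phi> (m + expo 0 0 1) = 0"
        by (simp add: linear_form_def distrib_right mult_single add single add.commute[of _ m])
    qed
    moreover have "\<exists>m. mon_degree m = Suc j \<and> \<phi> m \<noteq> 0"
    proof (rule ccontr)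
      assume "\<not> ?thesis"
      then have z: "\<phi> m = 0" if "m \<in> Poly_Mapping.keys f" for m
        using f(1) that by (auto simp: homogeneous_part_def)
      have "\<psi> f = \<psi> (\<Sum>m\<in>Poly_Mapping.keys f. Poly_Mapping.single m (Poly_Mapping.lookup f m))"
        by (rule arg_cong[where f = \<psi>], rule poly_mapping_expand) simp_all
      also have "\<dots> = 0" by (simp add: sum single z)
      finally show False using \<psi>(3) by simp
    qed
    ultimately show "\<exists>\<phi> m. annihilates a b c I j \<phi> \<and> mon_degree m = Suc j \<and> \<phi> m \<noteq> 0" by blast
  next
    assume "\<exists>\<phi> m. annihilates a b c I j \<phi> \<and> mon_degree m = Suc j \<and> \<phi> m \<noteq> 0"
    then obtain \<phi> m where \<phi>: "annihilates a b c I j \<phi>" "mon_degree m = Suc j" "\<phi> m \<noteq> 0" by blast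
    show "(\<lambda>u. l \<otimes>\<^bsub>poly3_ring Quot I\<^esub> u) ` quot_part I j \<noteq> quot_part I (Suc j)"
    proof
      assume "(\<lambda>u. l \<otimes>\<^bsub>poly3_ring Quot I\<^esub> u) ` quot_part I j = quot_part I (Suc j)"
      moreover have "?h (xpow m) \<in> quot_part I (Suc j)"
        unfolding quot_part_def homogeneous_part_supported using \<phi>(2) by (intro imageI supported_single) simp
      ultimately have "?h (xpow m) \<in> (\<lambda>g. ?h (?l * g)) ` homogeneous_part j"
        unfolding im by simp
      then obtain g where g: "g \<in> homogeneous_part j" "xpow m - ?l * g \<in> I"
        by (auto simp: coset_eq_iff[OF id])
      have "pairing (Suc j) \<phi> (xpow m - ?l * g) = \<phi> m"
        unfolding pairing_diff pairing_linear_form_mult[OF \<phi>(1) g(1)] pairing_single[OF \<phi>(2)] by simp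
      then show False using pairing_ideal[OF I \<phi>(1) g(2)] \<phi>(3) by simp
    qed
  qed
qed

text \<open>Dual form of upward propagation of surjectivity: compose the functional with
  multiplication by a variable. The variable is chosen to divide a monomial where the functional is
  nonzero.\<close>

lemma annihilates_shift:
  fixes I :: "'k::field poly3 set"
  assumes I: "monomial_ideal I" and ann: "annihilates a b c I (Suc j) \<phi>" and m: "mon_degree m = Suc (Suc j)" "\<phi> m \<noteq> 0"
  shows "\<exists>\<phi> m. annihilates a b c I j \<phi> \<and> mon_degree m = Suc j \<and> \<phi> m \<noteq> 0"
proof -
  obtain e n where e: "mon_degree e = 1" "m = n + e"
  proof -
    obtain i j k where ijk: "m = expo i j k" by (rule expo_cases)
    consider i' where "i = Suc i'" | j' where "j = Suc j'" | k' where "k = Suc k'"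
      using m(1) ijk by (cases i; cases j; cases k) auto
    then show ?thesis
    proof cases
      case 1
      then show ?thesis using that[of "expo 1 0 0" "expo i' j k"] by (simp add: ijk expo_add)
    next
      case 2
      then show ?thesis using that[of "expo 0 1 0" "expo i j' k"] by (simp add: ijk expo_add)
    next
      case 3
      then show ?thesis using that[of "expo 0 0 1" "expo i j k'"] by (simp add: ijk expo_add)
    qed
  qed
  define \<phi>' where "\<phi>' k = \<phi> (k + e)" for k
  have "annihilates a b c I j \<phi>'"
    unfolding annihilates_def
  proof (intro conjI ballI allI impI)
    fix k assume k: "k \<in> exponents I" "mon_degree k = Suc j"
    have "k + e \<in> exponents I"
      using monomial_ideal_eq_supported(3)[OF I k(1), of e] by (simp add: add.commute)
    then show "\<phi>' k = 0" using ann k e by (simp add: annihilates_def \<phi>'_def mon_degree_add)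
  next
    fix k assume "mon_degree k = j"
    then have "mon_degree (k + e) = Suc j" using e by (simp add: mon_degree_add)
    then have "a * \<phi> ((k + e) + expo 1 0 0) + b * \<phi> ((k + e) + expo 0 1 0) + c * \<phi> ((k + e) + expo 0 0 1) = 0"
      using ann by (simp add: annihilates_def)
    then show "a * \<phi>' (k + expo 1 0 0) + b * \<phi>' (k + expo 0 1 0) + c * \<phi>' (k + expo 0 0 1) = 0"
      by (simp add: \<phi>'_def ac_simps)
  qed
  moreover have "mon_degree n = Suc j" "\<phi>' n \<noteq> 0"
    using m e by (simp_all add: mon_degree_add \<phi>'_def)
  ultimately show ?thesis by blast
qed

lemma annihilates_descend:
  fixes I :: "'k::field poly3 set"
  assumes I: "monomial_ideal I" and "i \<le> j"
    and "\<exists>\<phi> m. annihilates a b c I j \<phi> \<and> mon_degree m = Suc j \<and> \<phi> m \<noteq> 0"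
  shows "\<exists>\<phi> m. annihilates a b c I i \<phi> \<and> mon_degree m = Suc i \<and> \<phi> m \<noteq> 0"
  using assms(2,3)
proof (induction j rule: dec_induct)
  case (step j)
  then show ?case using annihilates_shift[OF I] by blast
qed

section \<open>The degrees in which multiplication by the linear form can fail\<close>

lemma exponents_degree_ge:
  assumes "monomial_ideal I" "generated_in_degree d I" "m \<in> exponents I"
  shows "d \<le> mon_degree m"
  using generated_exponents[OF assms] by (metis le_add2 mon_degree_add)

text \<open>Nothing in \<open>I\<close> has degree below d, so the map is multiplication by a
  nonzero element of the domain S.\<close>

lemma inj_low_degree:
  fixes I :: "'k::field poly3 set"
  assumes I: "monomial_ideal I" "generated_in_degree d I" and j: "Suc j < d"
    and l: "linear_form a b c \<noteq> (0 :: 'k poly3)"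
  shows "inj_on (\<lambda>u. (I +>\<^bsub>poly3_ring\<^esub> linear_form a b c) \<otimes>\<^bsub>poly3_ring Quot I\<^esub> u) (quot_part I j)"
proof (rule inj_onI)
  note mono = monomial_ideal_eq_supported[OF I(1)]
  note id = mono(1)
  let ?h = "\<lambda>f. I +>\<^bsub>poly3_ring\<^esub> f"
  let ?l = "linear_form a b c"
  fix u v assume "u \<in> quot_part I j" "v \<in> quot_part I j"
    and eq: "?h ?l \<otimes>\<^bsub>poly3_ring Quot I\<^esub> u = ?h ?l \<otimes>\<^bsub>poly3_ring Quot I\<^esub> v"
  then obtain f g where fg: "f \<in> homogeneous_part j" "g \<in> homogeneous_part j" "u = ?h f" "v = ?h g"
    by (auto simp: quot_part_def)
  have fg': "f - g \<in> homogeneous_part j"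
    using fg(1,2) unfolding homogeneous_part_supported by (rule supported_diff)
  have "?l * (f - g) \<in> I"
    using eq by (simp add: fg quot_mult[OF id] coset_eq_iff[OF id] algebra_simps)
  then have "?l * (f - g) \<in> supported (exponents I)" using mono(2) by blast
  moreover have "?l * (f - g) \<in> homogeneous_part (Suc j)"
    by (rule linear_form_mult_homogeneous[OF fg'])
  ultimately have "Poly_Mapping.keys (?l * (f - g)) = {}"
    using exponents_degree_ge[OF I] j by (fastforce simp: supported_iff homogeneous_part_def)
  then have "?l * (f - g) = 0" by simp
  then have "f = g" using l by simp
  then show "u = v" by (simp add: fg)
qed

lemma not_weak_lefschetz_annihilates:
  fixes I :: "'k::field poly3 set"
  assumes I: "monomial_ideal I" "generated_in_degree d I" and d: "0 < d" and wlp: "\<not> weak_lefschetz I"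
  obtains \<phi> m where "annihilates 1 1 1 I (d - 1) \<phi>" "mon_degree m = d" "\<phi> m \<noteq> 0"
proof -
  let ?l = "linear_form 1 1 1 :: 'k poly3"
  let ?L = "\<lambda>u. (I +>\<^bsub>poly3_ring\<^esub> ?l) \<otimes>\<^bsub>poly3_ring Quot I\<^esub> u"
  have "I +>\<^bsub>poly3_ring\<^esub> ?l \<in> quot_part I 1"
    unfolding quot_part_def by (intro imageI linear_form_homogeneous)
  then obtain j where j: "\<not> inj_on ?L (quot_part I j)" "?L ` quot_part I j \<noteq> quot_part I (Suc j)"
    using wlp unfolding weak_lefschetz_def by blast
  have "Poly_Mapping.lookup ?l (expo 1 0 0) = 1"
    by (simp add: linear_form_def lookup_add lookup_single)
  then have "?l \<noteq> 0" by auto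
  then have "d - 1 \<le> j" using inj_low_degree[OF I] j(1) by (metis Suc_diff_1 Suc_leI d not_less_eq_eq not_less)
  moreover have "\<exists>\<phi> m. annihilates 1 1 1 I j \<phi> \<and> mon_degree m = Suc j \<and> \<phi> m \<noteq> 0"
    using j(2) not_surj_iff[OF I(1), of 1 1 1 j] by blast
  ultimately have "\<exists>\<phi> m. annihilates 1 1 1 I (d - 1) \<phi> \<and> mon_degree m = Suc (d - 1) \<and> \<phi> m \<noteq> 0"
    by (rule annihilates_descend[OF I(1)])
  then show ?thesis using that d by auto
qed

section \<open>From annihilating functionals to difference triangles\<close>

lemma interpolation_exists:
  fixes s :: "nat \<Rightarrow> 'a::field_char_0"
  shows "\<exists>p. degree p \<le> n \<and> (\<forall>i\<le>n. poly p (of_nat i) = s i)"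
proof (induction n)
  case 0
  show ?case by (intro exI[of _ "[:s 0:]"]) simp
next
  case (Suc n)
  then obtain p where p: "degree p \<le> n" "\<forall>i\<le>n. poly p (of_nat i) = s i" by blast
  let ?r = "poly (ff 0 (Suc n)) (of_nat (Suc n)) :: 'a"
  have "?r \<noteq> 0" unfolding poly_ff
    by (subst prod_zero_iff) (auto simp del: of_nat_Suc simp: of_nat_diff[symmetric] simp flip: of_nat_diff)
  define c where "c = (s (Suc n) - poly p (of_nat (Suc n))) / ?r"
  let ?q = "p + smult c (ff 0 (Suc n))"
  have "degree ?q \<le> Suc n"
    using p(1) by (intro degree_add_le) (auto simp: degree_ff degree_smult_le[THEN order_trans])
  moreover have "poly ?q (of_nat i) = s i" if "i \<le> Suc n" for i
  proof (cases "i = Suc n")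
    case True
    then show ?thesis using \<open>?r \<noteq> 0\<close> by (simp add: c_def)
  next
    case False
    then show ?thesis using that p(2) ff_root[of 0 i "Suc n", where 'a = 'a] by simp
  qed
  ultimately show ?case by blast
qed

text \<open>Read off the edge k = 0: \<open>p\<close> interpolates (-1)^i F(i, d - i, 0), the sign
  turning the three-term relation into differencing. Row k of the triangle then lists the values of
  \<open>F\<close> with last index k.\<close>

lemma annihilator_support_bound:
  fixes F :: "nat \<Rightarrow> nat \<Rightarrow> nat \<Rightarrow> 'a::field_char_0"
  assumes rec: "\<And>i j k. Suc (i + j + k) = d \<Longrightarrow> F (Suc i) j k + F i (Suc j) k + F i j (Suc k) = 0"
    and ends: "F d 0 0 = 0" "F 0 d 0 = 0" "F 0 0 d = 0"
    and nonzero: "i0 + j0 + k0 = d" "F i0 j0 k0 \<noteq> 0"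
  shows "3 * d \<le> card {(i, j, k). i + j + k = d \<and> F i j k \<noteq> 0} + (if odd d then 3 else 2)"
proof -
  obtain p where p: "degree p \<le> d" "\<forall>i\<le>d. poly p (of_nat i) = (-1) ^ i * F i (d - i) 0"
    using interpolation_exists[of d "\<lambda>i. (-1) ^ i * F i (d - i) 0"] by blast
  have row: "poly ((fd ^^ k) p) (of_nat i) = (-1) ^ i * F i (d - k - i) k" if "i + k \<le> d" for i k
    using that
  proof (induction k arbitrary: i)
    case 0
    then show ?case using p(2) by simp
  next
    case (Suc k)
    define j where "j = d - Suc k - i"
    have d: "d - k - Suc i = j" "d - k - i = Suc j" "Suc (i + j + k) = d"
      using Suc.prems by (auto simp: j_def)
    have F: "F i j (Suc k) = - F (Suc i) j k - F i (Suc j) k"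
      using rec[OF d(3)] by (simp add: algebra_simps eq_neg_iff_add_eq_0)
    have "poly ((fd ^^ Suc k) p) (of_nat i)
       = poly ((fd ^^ k) p) (of_nat (Suc i)) - poly ((fd ^^ k) p) (of_nat i)"
      by (simp add: poly_fd add.commute)
    also have "\<dots> = (-1) ^ Suc i * F (Suc i) j k - (-1) ^ i * F i (Suc j) k"
      using Suc.IH[of "Suc i"] Suc.IH[of i] Suc.prems d by simp
    also have "\<dots> = (-1) ^ i * F i j (Suc k)" by (simp add: F algebra_simps)
    finally show ?case by (simp add: j_def)
  qed
  have "p \<noteq> 0"
  proof
    assume "p = 0"
    then have "F i0 (d - k0 - i0) k0 = 0" using row[of i0 k0] nonzero(1) by simp
    moreover have "d - k0 - i0 = j0" using nonzero(1) by simp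
    ultimately show False using nonzero(2) by simp
  qed
  \<comment> \<open>The d-th difference is the single value \<open>F 0 0 d\<close>, which vanishes;
    degree d would make it a nonzero constant.\<close>
  moreover have "degree p < d"
  proof (rule ccontr)
    assume "\<not> ?thesis"
    then have deg: "degree p = d" using p(1) by simp
    then have "degree ((fd ^^ d) p) = 0" by (simp add: degree_fd_pow)
    then obtain c where c: "(fd ^^ d) p = [:c:]" by (rule degree_eq_zeroE)
    have "poly ((fd ^^ d) p) (of_nat 0) = 0" using row[of 0 d] ends by simp
    then show False using fd_pow_nonzero[OF \<open>p \<noteq> 0\<close>, of d] deg c by simp
  qed
  moreover have "poly p 0 = 0" "poly p (of_nat d) = 0"
    using p(2)[rule_format, of 0] p(2)[rule_format, of d] ends by simp_all
  ultimately have "3 * d \<le> total_nz d p + (if odd d then 3 else 2)"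
    by (rule total_nz_lower_bound)
  moreover have "total_nz d p = card (SIGMA k:{..d}. nz (d - k) ((fd ^^ k) p))"
    by (simp add: total_nz_def)
  also have "\<dots> = card {(i, j, k). i + j + k = d \<and> F i j k \<noteq> 0}"
    by (rule bij_betw_same_card[of "\<lambda>(k, i). (i, d - k - i, k)"],
        rule bij_betwI[where g = "\<lambda>(i, j, k). (k, i)"])
       (auto simp: nz_iff row)
  finally show ?thesis by simp
qed

text \<open>Monomials on which the functional is nonzero lie outside \<open>I\<close>, so the size
  of its support bounds the Hilbert function from below.\<close>

lemma hilbert_lower_bound:
  fixes I :: "'k::field_char_0 poly3 set"
  assumes d: "2 \<le> d" and I: "artinian_ideal I" "monomial_ideal I" "generated_in_degree d I"
    and wlp: "\<not> weak_lefschetz I"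
  shows "(if odd d then 3 * d - 3 else 3 * d - 2) \<le> hilbert_function I d"
proof -
  obtain \<phi> m where \<phi>: "annihilates 1 1 1 I (d - 1) \<phi>" "mon_degree m = d" "\<phi> m \<noteq> 0"
    using not_weak_lefschetz_annihilates[OF I(2,3) _ wlp] d by auto
  define F where "F i j k = \<phi> (expo i j k)" for i j k
  obtain i0 j0 k0 where m: "m = expo i0 j0 k0" by (rule expo_cases)
  have dS: "Suc (d - 1) = d" using d by simp
  have E: "\<phi> m = 0" if "m \<in> exponents I" "mon_degree m = d" for m
    using \<phi>(1) that unfolding annihilates_def dS by blast
  have "expo d 0 0 = Poly_Mapping.single 0 d" "expo 0 d 0 = Poly_Mapping.single 1 d"
    "expo 0 0 d = Poly_Mapping.single 2 d"
    by (simp_all add: expo_def)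
  then have "expo d 0 0 \<in> exponents I" "expo 0 d 0 \<in> exponents I" "expo 0 0 d \<in> exponents I"
    using generator_pure_power[OF I] by simp_all
  then have pure: "F d 0 0 = 0" "F 0 d 0 = 0" "F 0 0 d = 0"
    by (simp_all add: F_def E)
  have rec: "F (Suc i) j k + F i (Suc j) k + F i j (Suc k) = 0" if "Suc (i + j + k) = d" for i j k
  proof -
    have "mon_degree (expo i j k) = d - 1" using that by auto
    then have "\<phi> (expo i j k + expo 1 0 0) + \<phi> (expo i j k + expo 0 1 0) + \<phi> (expo i j k + expo 0 0 1) = 0"
      using \<phi>(1) by (simp add: annihilates_def)
    then show ?thesis by (simp add: expo_add F_def)
  qed
  have "3 * d \<le> card {(i, j, k). i + j + k = d \<and> F i j k \<noteq> 0} + (if odd d then 3 else 2)"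
    using \<phi>(2,3) by (intro annihilator_support_bound[OF rec pure, of i0 j0 k0]) (auto simp: m F_def)
  moreover have "card {(i, j, k). i + j + k = d \<and> F i j k \<noteq> 0} = card {m. mon_degree m = d \<and> \<phi> m \<noteq> 0}"
    by (simp add: card_exponents_of_degree F_def)
  moreover have "card {m. mon_degree m = d \<and> \<phi> m \<noteq> 0} \<le> card {m. mon_degree m = d \<and> m \<notin> exponents I}"
    using E by (intro card_mono) (auto intro: finite_subset[OF _ finite_mon_degree[of d]])
  moreover have "1 \<notin> I"
  proof
    assume "1 \<in> I"
    then have "0 \<in> exponents I" by (simp add: exponents_def)
    then have "d \<le> mon_degree 0" by (rule exponents_degree_ge[OF I(2,3)])
    then show False using d by (simp add: mon_degree_def)
  qed
  then have "hilbert_function I d = card {m. mon_degree m = d \<and> m \<notin> exponents I}"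
    by (rule hilbert_function_eq_card[OF I(2)])
  ultimately show ?thesis by auto
qed

section \<open>Artinian monomial quotients and the sharp example\<close>

lemma (in vector_space) descending_chain_stabilizes:
  assumes W: "\<And>n. subspace (W n)" "\<And>n. W (Suc n) \<subseteq> W n" and T: "finite T" "W 0 \<subseteq> span T"
  shows "\<exists>N. \<forall>n\<ge>N. W n = W N"
proof -
  have anti: "W n \<subseteq> W m" if "m \<le> n" for m n
    using W(2) that by (rule lift_Suc_antimono_le)
  define N where "N = (ARG_MIN (\<lambda>n. dim (W n)) n. True)"
  have min: "dim (W N) \<le> dim (W n)" for n
    unfolding N_def by (rule arg_min_nat_le) simp
  have "W n = W N" if n: "N \<le> n" for n
  proof (rule ccontr)
    assume "W n \<noteq> W N"
    then obtain x where x: "x \<in> W N" "x \<notin> W n" using anti[OF n] by blast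
    obtain B where B: "B \<subseteq> W n" "independent B" "W n \<subseteq> span B" "card B = dim (W n)"
      by (rule basis_exists)
    obtain C where C: "C \<subseteq> W N" "independent C" "W N \<subseteq> span C" "card C = dim (W N)"
      by (rule basis_exists)
    have "C \<subseteq> span T" using C(1) anti[of 0 N] T(2) by blast
    then have finC: "finite C" using independent_span_bound[OF T(1) C(2)] by blast
    have "span B \<subseteq> W n" using B(1) W(1) by (rule span_minimal)
    then have "x \<notin> span B" using x(2) by blast
    then have "independent (insert x B)" using B(2) by (rule independent_insertI)
    moreover have "insert x B \<subseteq> span C" using x(1) B(1) anti[OF n] C(3) by blast
    ultimately have "finite (insert x B) \<and> card (insert x B) \<le> card C"
      by (rule independent_span_bound[OF finC])
    moreover have "x \<notin> B" using B(1) x(2) by blast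
    ultimately have "Suc (card B) \<le> card C" by (metis card_insert_disjoint finite_insert)
    then show False using min[of n] B(4) C(4) by simp
  qed
  then show ?thesis by blast
qed

lemma supported_in_span:
  fixes f :: "'k::field poly3"
  assumes "f \<in> supported A"
  shows "f \<in> module.span (\<lambda>c f. const c * f) (xpow ` A)"
proof -
  interpret P: vector_space "\<lambda>(c::'k) (f::'k poly3). const c * f" by (rule vector_space_poly3)
  have "(\<Sum>m\<in>Poly_Mapping.keys f. const (Poly_Mapping.lookup f m) * xpow m) \<in> P.span (xpow ` A)"
    using assms by (intro P.span_sum P.span_scale P.span_base) (auto simp: supported_iff)
  moreover have "f = (\<Sum>m\<in>Poly_Mapping.keys f. const (Poly_Mapping.lookup f m) * xpow m)"
    unfolding single_eq_const_mult[symmetric] by (rule poly_mapping_expand) simp_all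
  ultimately show ?thesis by simp
qed

text \<open>Every ideal of the quotient is the image of its preimage among combinations of standard
  monomials, so a descending chain of ideals becomes one of subspaces of a finite-dimensional
  space.\<close>

lemma artinian_if_finite_complement:
  fixes I :: "'k::field poly3 set"
  assumes I: "monomial_ideal I" and fin: "finite (- exponents I)"
  shows "artinian_ideal I"
  unfolding artinian_ideal_def artinian_ring_def
proof (intro conjI allI impI)
  note id = monomial_ideal_eq_supported(1)[OF I]
  show "ideal I poly3_ring" by (rule id)
  fix J assume J: "(\<forall>n. ideal (J n) (poly3_ring Quot I)) \<and> (\<forall>n. J (Suc n) \<subseteq> J n)"
  interpret P: vector_space "\<lambda>(c::'k) (f::'k poly3). const c * f" by (rule vector_space_poly3)
  interpret Q: ring "poly3_ring Quot I" by (rule quot_ring[OF id])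
  let ?h = "\<lambda>f. I +>\<^bsub>poly3_ring\<^esub> f"
  define W where "W n = {f \<in> supported (- exponents I). ?h f \<in> J n}" for n
  have idJ: "ideal (J n) (poly3_ring Quot I)" for n using J by blast
  have "P.subspace (W n)" for n
  proof -
    interpret Jn: ideal "J n" "poly3_ring Quot I" by (rule idJ)
    show ?thesis
    proof (rule P.subspaceI)
      show "0 \<in> W n"
        using Jn.zero_closed by (simp add: W_def quot_zero[OF id])
      show "f + g \<in> W n" if "f \<in> W n" "g \<in> W n" for f g
        using that Jn.a_closed[of "?h f" "?h g"] by (auto simp: W_def quot_add[OF id] intro: supported_add)
      show "const c * f \<in> W n" if "f \<in> W n" for c f
        using that Jn.I_l_closed[of "?h f" "?h (const c)"]
        by (auto simp: W_def quot_mult[OF id] quot_carrier[OF id] supported_iff in_keys_iff lookup_const_mult)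
    qed
  qed
  moreover have "W (Suc n) \<subseteq> W n" for n using J by (auto simp: W_def)
  moreover have "W 0 \<subseteq> P.span (xpow ` (- exponents I))"
    using supported_in_span by (auto simp: W_def)
  ultimately have "\<exists>N. \<forall>n\<ge>N. W n = W N"
    using fin by (intro P.descending_chain_stabilizes[where T = "xpow ` (- exponents I)"]) auto
  then obtain N where N: "\<forall>n\<ge>N. W n = W N" ..
  have JW: "J n = ?h ` W n" for n
  proof (intro Set.set_eqI iffI)
    fix u assume u: "u \<in> J n"
    interpret Jn: ideal "J n" "poly3_ring Quot I" by (rule idJ)
    have "u \<in> carrier (poly3_ring Quot I)" using Jn.a_subset u by blast
    then obtain f where f: "u = ?h f" by (auto simp: quot_carrier[OF id])
    obtain g where g: "g \<in> supported (UNIV - exponents I)" "f - g \<in> I"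
      using reduce_mod_monomial_ideal[OF I, of f UNIV] by (auto simp: supported_iff)
    have "u = ?h g" unfolding f coset_eq_iff[OF id] by (rule g(2))
    moreover have "g \<in> W n" using g(1) u \<open>u = ?h g\<close> by (simp add: W_def Compl_eq_Diff_UNIV)
    ultimately show "u \<in> ?h ` W n" by blast
  qed (auto simp: W_def)
  show "\<exists>N. \<forall>n\<ge>N. J n = J N"
    unfolding JW using N by metis
qed

lemma independent_monomials:
  "\<not> module.dependent (\<lambda>(c::'k::field) f. const c * f) (xpow ` A :: 'k poly3 set)"
proof -
  interpret P: vector_space "\<lambda>(c::'k) (f::'k poly3). const c * f" by (rule vector_space_poly3)
  show ?thesis
    unfolding P.dependent_def
  proof clarify
    fix m assume "m \<in> A" and span: "xpow m \<in> P.span (xpow ` A - {xpow m :: 'k poly3})"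
    have "P.subspace {f. Poly_Mapping.lookup f m = 0}"
      by (rule P.subspaceI) (auto simp: lookup_add lookup_const_mult)
    moreover have "xpow ` A - {xpow m} \<subseteq> {f :: 'k poly3. Poly_Mapping.lookup f m = 0}"
      by (auto simp: lookup_single when_def)
    ultimately have "xpow m \<in> {f :: 'k poly3. Poly_Mapping.lookup f m = 0}"
      using span P.span_minimal by blast
    then show False by simp
  qed
qed

text \<open>The image of an injective map would be too large to lie in the kernel of the functional \<open>\<phi>\<close>.\<close>

lemma not_inj_if_annihilated:
  fixes I :: "'k::field poly3 set"
  assumes I: "monomial_ideal I" "generated_in_degree (Suc n) I"
    and ann: "annihilates a b c I n \<phi>" "mon_degree m0 = Suc n" "\<phi> m0 \<noteq> 0"
    and card: "card {m. mon_degree m = Suc n \<and> m \<notin> exponents I} \<le> card {m. mon_degree m = n}"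
  shows "\<not> inj_on (\<lambda>u. (I +>\<^bsub>poly3_ring\<^esub> linear_form a b c) \<otimes>\<^bsub>poly3_ring Quot I\<^esub> u) (quot_part I n)"
proof
  note mono = monomial_ideal_eq_supported[OF I(1)]
  note id = mono(1)
  let ?h = "\<lambda>f. I +>\<^bsub>poly3_ring\<^esub> f"
  let ?l = "linear_form a b c"
  assume inj: "inj_on (\<lambda>u. ?h ?l \<otimes>\<^bsub>poly3_ring Quot I\<^esub> u) (quot_part I n)"
  interpret P: vector_space "\<lambda>(c::'k) (f::'k poly3). const c * f" by (rule vector_space_poly3)
  interpret PP: vector_space_pair "\<lambda>(c::'k) (f::'k poly3). const c * f" "\<lambda>(c::'k) (f::'k poly3). const c * f" ..
  define M where "M = {m. mon_degree m = Suc n \<and> m \<notin> exponents I}"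
  define S where "S = {m. mon_degree m = n}"
  have finM: "finite M" unfolding M_def by (rule finite_subset[OF _ finite_mon_degree[of "Suc n"]]) auto
  \<comment> \<open>\<open>T\<close> multiplies by the form and keeps only the terms outside
    \<open>I\<close>: the quotient map rewritten as a linear map of polynomials.\<close>
  define T where "T g = (\<Sum>m\<in>M. Poly_Mapping.single m (Poly_Mapping.lookup (?l * g) m))" for g
  have lookup_T: "Poly_Mapping.lookup (T g) k = (if k \<in> M then Poly_Mapping.lookup (?l * g) k else 0)" for g k
  proof -
    have "Poly_Mapping.lookup (T g) k = (\<Sum>m\<in>M. if m = k then Poly_Mapping.lookup (?l * g) k else 0)"
      unfolding T_def lookup_sum by (intro sum.cong refl) (auto simp: lookup_single when_def)
    then show ?thesis using finM by (simp add: sum.delta)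
  qed
  have lin: "Vector_Spaces.linear (\<lambda>c f. const c * f) (\<lambda>c f. const c * f) T"
  proof (unfold_locales, goal_cases)
    case (1 x y)
    show ?case by (rule poly_mapping_eqI) (simp add: lookup_T lookup_add distrib_left)
  next
    case (2 r x)
    have lx: "?l * (const r * x) = const r * (?l * x)" by (simp add: mult.left_commute)
    show ?case by (rule poly_mapping_eqI) (simp add: lookup_T lookup_const_mult lx)
  qed
  have diff: "?l * g - T g \<in> I" if "g \<in> homogeneous_part n" for g
  proof -
    have "?l * g \<in> homogeneous_part (Suc n)" by (rule linear_form_mult_homogeneous[OF that])
    then have "?l * g - T g \<in> supported (exponents I)"
      by (auto simp: supported_iff in_keys_iff lookup_minus lookup_T M_def homogeneous_part_def split: if_splits)
    then show ?thesis using mono(2) by blast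
  qed
  have ker: "g = 0" if g: "g \<in> homogeneous_part n" "T g = 0" for g
  proof -
    have 0: "0 \<in> homogeneous_part n" by (simp add: homogeneous_part_supported)
    have "?h ?l \<otimes>\<^bsub>poly3_ring Quot I\<^esub> ?h g = ?h ?l \<otimes>\<^bsub>poly3_ring Quot I\<^esub> ?h 0"
      using diff[OF g(1)] g(2) by (simp add: quot_mult[OF id] coset_eq_iff[OF id])
    then have "?h g = ?h 0"
      using inj_onD[OF inj] g(1) 0 unfolding quot_part_def by blast
    then have "g \<in> I" by (simp add: coset_eq_iff[OF id])
    then have "g \<in> supported (exponents I)" using mono(2) by blast
    then have "Poly_Mapping.keys g = {}"
      using g(1) exponents_degree_ge[OF I] by (fastforce simp: supported_iff homogeneous_part_def)
    then show ?thesis by simp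
  qed
  have spanS: "P.span (xpow ` S) \<subseteq> homogeneous_part n"
  proof (rule P.span_minimal)
    show "P.subspace (homogeneous_part n)"
      unfolding homogeneous_part_supported
      by (rule P.subspaceI) (auto intro: supported_add supported_const_mult)
  qed (auto simp: S_def homogeneous_part_def)
  have injT: "inj_on T (P.span (xpow ` S))"
    using PP.linear_inj_on_iff_eq_0[OF lin P.subspace_span] ker spanS by blast
  have ind: "P.independent (T ` xpow ` S)"
    by (rule PP.linear_independent_injective_image[OF lin independent_monomials injT])
  have cardT: "card (T ` xpow ` S) = card S"
  proof -
    have "inj_on T (xpow ` S)" using injT P.span_superset by (rule inj_on_subset)
    moreover have "inj_on (xpow :: _ \<Rightarrow> 'k poly3) S"
      by (rule inj_onI) (drule arg_cong[where f = Poly_Mapping.keys], simp)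
    ultimately show ?thesis by (simp add: card_image)
  qed
  have "P.span (T ` xpow ` S) \<subseteq> {f. pairing (Suc n) \<phi> f = 0}"
  proof (rule P.span_minimal)
    show "P.subspace {f. pairing (Suc n) \<phi> f = 0}"
      by (rule P.subspaceI)
         (auto simp: pairing_add pairing_const_mult)
    show "T ` xpow ` S \<subseteq> {f. pairing (Suc n) \<phi> f = 0}"
    proof clarify
      fix m assume "m \<in> S"
      then have g: "xpow m \<in> (homogeneous_part n :: 'k poly3 set)" by (simp add: S_def homogeneous_part_def)
      have "pairing (Suc n) \<phi> (?l * xpow m - T (xpow m)) = 0"
        by (rule pairing_ideal[OF I(1) ann(1) diff[OF g]])
      then show "pairing (Suc n) \<phi> (T (xpow m)) = 0"
        unfolding pairing_diff pairing_linear_form_mult[OF ann(1) g] by simp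
    qed
  qed
  \<comment> \<open>The images lie in the kernel of the functional and \<open>xpow m0\<close> does
    not, so injectivity would give one independent vector more than there are monomials in
    \<open>S\<close>, all inside the span of \<open>M\<close>.\<close>
  then have new: "xpow m0 \<notin> P.span (T ` xpow ` S)"
    using ann(3) pairing_single[OF ann(2), of \<phi> 1] by auto
  then have "P.independent (insert (xpow m0) (T ` xpow ` S))"
    using ind by (rule P.independent_insertI)
  moreover have "insert (xpow m0) (T ` xpow ` S) \<subseteq> P.span (xpow ` M)"
  proof -
    have "m0 \<in> M" using ann unfolding M_def annihilates_def by blast
    moreover have "T g \<in> supported M" for g unfolding T_def by (intro supported_sum supported_single)
    ultimately show ?thesis using supported_in_span by (auto intro: P.span_base)
  qed
  ultimately have fin: "finite (insert (xpow m0) (T ` xpow ` S)) \<and> card (insert (xpow m0) (T ` xpow ` S)) \<le> card (xpow ` M :: 'k poly3 set)"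
    using finM by (intro P.independent_span_bound) auto
  have "xpow m0 \<notin> T ` xpow ` S" using new P.span_base[of "xpow m0" "T ` xpow ` S"] by argo
  moreover have "finite (T ` xpow ` S)" using fin by (simp only: finite_insert)
  ultimately have "card (insert (xpow m0) (T ` xpow ` S)) = Suc (card S)"
    by (metis card_insert_disjoint cardT)
  moreover have "card (xpow ` M :: 'k poly3 set) \<le> card M" by (rule card_image_le[OF finM])
  ultimately have "Suc (card S) \<le> card M" using fin by linarith
  then show False using card by (simp add: M_def S_def)
qed

text \<open>The differences of \<open>p = x(x - d)\<close> at \<open>i\<close>, rewritten with \<open>d = i + j + k\<close>.\<close>

definition extremal_coeff :: "nat \<Rightarrow> nat \<Rightarrow> nat \<Rightarrow> 'k::field_char_0" where
  "extremal_coeff i j k = (-1) ^ i *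
     (if k = 0 then - of_nat (i * j) else if k = 1 then of_nat i - of_nat j else if k = 2 then 2 else 0)"

lemma extremal_coeff_rec:
  "extremal_coeff (Suc i) j k + extremal_coeff i (Suc j) k + extremal_coeff i j (Suc k) = 0"
proof -
  consider "k = 0" | "k = 1" | "k = 2" | "2 < k" by linarith
  then show ?thesis by cases (simp_all add: extremal_coeff_def algebra_simps)
qed

definition in_support :: "nat \<Rightarrow> nat \<Rightarrow> nat \<Rightarrow> bool" where
  "in_support i j k \<longleftrightarrow> k = 0 \<and> 0 < i \<and> 0 < j \<or> k = 1 \<and> i \<noteq> j \<or> k = 2"

lemma extremal_coeff_nonzero_iff:
  "(extremal_coeff i j k :: 'k::field_char_0) \<noteq> 0 \<longleftrightarrow> in_support i j k"
  by (auto simp: extremal_coeff_def in_support_def)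

text \<open>Rows 0 and 2 have d - 1 nonzero entries each. Row 1 has d positions and loses the one
  with i = j, which exists exactly for odd d; this is the parity in the bound.\<close>

lemma card_support:
  assumes d: "3 \<le> d"
  shows "card {(i, j, k). i + j + k = d \<and> in_support i j k} = (if odd d then 3 * d - 3 else 3 * d - 2)"
proof -
  define S0 S1 S2 where "S0 = (\<lambda>i. (i, d - i, 0::nat)) ` {0<..<d}"
    and "S1 = (\<lambda>i. (i, d - 1 - i, 1::nat)) ` ({..<d} - {i. 2 * i + 1 = d})"
    and "S2 = (\<lambda>i. (i, d - 2 - i, 2::nat)) ` {..d - 2}"
  have "{(i, j, k). i + j + k = d \<and> in_support i j k} = S0 \<union> S1 \<union> S2"
  proof (intro Set.set_eqI iffI)
    fix t assume "t \<in> {(i, j, k). i + j + k = d \<and> in_support i j k}"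
    then obtain i j k where t: "t = (i, j, k)" "i + j + k = d" "in_support i j k" by auto
    then consider "k = 0" "0 < i" "0 < j" | "k = 1" "i \<noteq> j" | "k = 2" by (auto simp: in_support_def)
    then show "t \<in> S0 \<union> S1 \<union> S2"
    proof cases
      case 1
      then have "t \<in> S0" unfolding S0_def using t by (intro image_eqI[of _ _ i]) auto
      then show ?thesis by simp
    next
      case 2
      then have "t \<in> S1" unfolding S1_def using t by (intro image_eqI[of _ _ i]) auto
      then show ?thesis by simp
    next
      case 3
      then have "t \<in> S2" unfolding S2_def using t by (intro image_eqI[of _ _ i]) auto
      then show ?thesis by simp
    qed
  next
    fix t assume "t \<in> S0 \<union> S1 \<union> S2"
    then show "t \<in> {(i, j, k). i + j + k = d \<and> in_support i j k}"
      using d by (auto simp: S0_def S1_def S2_def in_support_def)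
  qed
  moreover have "card (S0 \<union> S1 \<union> S2) = card S0 + card S1 + card S2"
    by (subst card_Un_disjoint, simp add: S0_def S1_def, simp add: S2_def, force simp: S0_def S1_def S2_def,
        subst card_Un_disjoint) (auto simp: S0_def S1_def)
  moreover have "card S0 = d - 1" unfolding S0_def by (subst card_image) (auto simp: inj_on_def)
  moreover have "card S2 = d - 1" unfolding S2_def using d by (subst card_image) (auto simp: inj_on_def)
  moreover have "card S1 = (if odd d then d - 1 else d)"
  proof -
    have "card S1 = card ({..<d} - {i. 2 * i + 1 = d})"
      unfolding S1_def by (rule card_image) (auto simp: inj_on_def)
    also have "\<dots> = (if odd d then d - 1 else d)"
    proof (cases "odd d")
      case True
      then obtain e where e: "d = 2 * e + 1" by (rule oddE)
      then have "{i. 2 * i + 1 = d} = {e}" by auto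
      then show ?thesis using True e by (simp add: card_Diff_subset)
    next
      case False
      then have "{i. 2 * i + 1 = d} = {}" by auto
      then show ?thesis using False by simp
    qed
    finally show ?thesis .
  qed
  ultimately show ?thesis using d by (simp split: if_split, linarith)
qed

lemma card_triples: "2 * card {(i, j, k). i + j + k = n} = (n + 1) * (n + 2)"
proof -
  have "card {(i, j, k). i + j + k = n} = card (SIGMA k:{..n}. {..n - k})"
    by (rule bij_betw_same_card[of "\<lambda>(i, j, k). (k, i)"],
        rule bij_betwI[where g = "\<lambda>(k, i). (i, n - k - i, k)"]) auto
  also have "\<dots> = (\<Sum>k\<le>n. Suc (n - k))" by simp
  also have "\<dots> = (\<Sum>k\<le>n. Suc k)"
    using sum.nat_diff_reindex[of Suc "Suc n"] by (simp add: lessThan_Suc_atMost)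
  finally have "card {(i, j, k). i + j + k = n} = (\<Sum>k\<le>n. Suc k)" .
  moreover have "2 * (\<Sum>k\<le>n. Suc k) = (n + 1) * (n + 2)" by (induction n) auto
  ultimately show ?thesis by simp
qed

section \<open>The ideal generated by the monomials outside the support\<close>

definition sharp_generators :: "nat \<Rightarrow> (3 \<Rightarrow>\<^sub>0 nat) set" where
  "sharp_generators d = {expo i j k | i j k. i + j + k = d \<and> \<not> in_support i j k}"

text \<open>The largest monomial ideal generated in degree d that the extremal functional kills,
  hence the one of smallest Hilbert function value there.\<close>

definition sharp_ideal :: "nat \<Rightarrow> 'k::field poly3 set" where
  "sharp_ideal d = Idl\<^bsub>poly3_ring\<^esub> (xpow ` sharp_generators d)"

lemma sharp_ideal_monomial: "monomial_ideal (sharp_ideal d :: 'k::field poly3 set)"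
  unfolding monomial_ideal_def sharp_ideal_def
  by (intro exI[of _ "xpow ` sharp_generators d"]) (auto simp: monomials_def)

lemma sharp_ideal_generated: "generated_in_degree d (sharp_ideal d :: 'k::field poly3 set)"
  unfolding generated_in_degree_def sharp_ideal_def
  by (intro exI[of _ "xpow ` sharp_generators d"]) (auto simp: homogeneous_part_def sharp_generators_def)

lemma sharp_generators_subset: "sharp_generators d \<subseteq> exponents (sharp_ideal d :: 'k::field poly3 set)"
proof -
  interpret R: ring "poly3_ring :: 'k poly3 ring" by (rule ring_poly3)
  show ?thesis
    unfolding sharp_ideal_def exponents_def using R.genideal_self[of "xpow ` sharp_generators d"] by auto
qed

lemma exponents_sharp_ideal:
  assumes "i + j + k = d"
  shows "expo i j k \<in> exponents (sharp_ideal d :: 'k::field poly3 set) \<longleftrightarrow> \<not> in_support i j k"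
proof
  interpret R: ring "poly3_ring :: 'k poly3 ring" by (rule ring_poly3)
  assume m: "expo i j k \<in> exponents (sharp_ideal d :: 'k poly3 set)"
  \<comment> \<open>Closed under multiplication because a nontrivial multiple has degree above d,
    where no further condition is imposed.\<close>
  define D where "D = {m. mon_degree m = d \<longrightarrow> m \<in> sharp_generators d} \<inter> {m. d \<le> mon_degree m}"
  have "ideal (supported D) (poly3_ring :: 'k poly3 ring)"
  proof (rule poly3_idealI)
    fix f g :: "'k poly3" assume f: "f \<in> supported D"
    have "m + n \<in> D" if "n \<in> D" for m n
    proof (cases "mon_degree m = 0")
      case True
      obtain i j k where ijk: "m = expo i j k" by (rule expo_cases)
      then have "i = 0" "j = 0" "k = 0" using True by simp_all
      then have "m = 0" using ijk by (simp add: expo_def)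
      then show ?thesis using that by simp
    next
      case False
      then show ?thesis using that by (auto simp: D_def mon_degree_add)
    qed
    then show "g * f \<in> supported D"
      using f by (intro supported_mult[of g UNIV]) (auto simp: supported_iff)
  qed (auto intro: supported_add)
  moreover have "xpow ` sharp_generators d \<subseteq> (supported D :: 'k poly3 set)"
    by (auto intro!: supported_single simp: D_def sharp_generators_def)
  ultimately have "sharp_ideal d \<subseteq> (supported D :: 'k poly3 set)"
    unfolding sharp_ideal_def by (rule R.genideal_minimal)
  then have "xpow (expo i j k) \<in> (supported D :: 'k poly3 set)"
    using m by (auto simp: exponents_def)
  then have "expo i j k \<in> sharp_generators d"
    using assms by (simp add: supported_iff D_def)
  then show "\<not> in_support i j k" by (auto simp: sharp_generators_def)
next
  assume "\<not> in_support i j k"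
  then have "expo i j k \<in> sharp_generators d" using assms by (auto simp: sharp_generators_def)
  then show "expo i j k \<in> exponents (sharp_ideal d :: 'k poly3 set)"
    using sharp_generators_subset by blast
qed

text \<open>The bound 3 <= d keeps all pure powers off the support; for d = 2 the square of the
  third variable would lie on row 2.\<close>

lemma sharp_ideal_artinian:
  assumes d: "3 \<le> d"
  shows "artinian_ideal (sharp_ideal d :: 'k::field poly3 set)"
proof (rule artinian_if_finite_complement[OF sharp_ideal_monomial])
  let ?E = "exponents (sharp_ideal d :: 'k poly3 set)"
  have pure: "expo d 0 0 \<in> ?E" "expo 0 d 0 \<in> ?E" "expo 0 0 d \<in> ?E"
    using d by (simp_all add: exponents_sharp_ideal in_support_def)
  have "- ?E \<subseteq> (\<lambda>(i, j, k). expo i j k) ` ({..<d} \<times> {..<d} \<times> {..<d})"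
  proof
    fix m assume m: "m \<in> - ?E"
    obtain i j k where ijk: "m = expo i j k" by (rule expo_cases)
    have up: "expo i j k + n \<in> ?E" if "n \<in> ?E" for i j k n
      by (rule monomial_ideal_eq_supported(3)[OF sharp_ideal_monomial that])
    have "i < d"
      using m up[OF pure(1), of "i - d" j k] by (auto simp: ijk expo_add intro: ccontr)
    moreover have "j < d"
      using m up[OF pure(2), of i "j - d" k] by (auto simp: ijk expo_add intro: ccontr)
    moreover have "k < d"
      using m up[OF pure(3), of i j "k - d"] by (auto simp: ijk expo_add intro: ccontr)
    ultimately show "m \<in> (\<lambda>(i, j, k). expo i j k) ` ({..<d} \<times> {..<d} \<times> {..<d})"
      by (auto simp: ijk intro!: image_eqI[of _ _ "(i, j, k)"])
  qed
  then show "finite (- ?E)" by (rule finite_subset) auto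
qed

lemma card_sharp_complement:
  assumes d: "3 \<le> d"
  shows "card {m. mon_degree m = d \<and> m \<notin> exponents (sharp_ideal d :: 'k::field poly3 set)}
    = (if odd d then 3 * d - 3 else 3 * d - 2)"
proof -
  have "{(i, j, k). i + j + k = d \<and> expo i j k \<notin> exponents (sharp_ideal d :: 'k poly3 set)}
      = {(i, j, k). i + j + k = d \<and> in_support i j k}"
    by (auto simp: exponents_sharp_ideal)
  then show ?thesis by (simp only: card_exponents_of_degree card_support[OF d])
qed

lemma hilbert_sharp_ideal:
  assumes d: "3 \<le> d"
  shows "hilbert_function (sharp_ideal d :: 'k::field poly3 set) d = (if odd d then 3 * d - 3 else 3 * d - 2)"
proof -
  have "1 \<notin> (sharp_ideal d :: 'k poly3 set)"
  proof
    assume "1 \<in> (sharp_ideal d :: 'k poly3 set)"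
    then have "0 \<in> exponents (sharp_ideal d :: 'k poly3 set)" by (simp add: exponents_def)
    then have "d \<le> mon_degree 0"
      by (rule exponents_degree_ge[OF sharp_ideal_monomial sharp_ideal_generated])
    then show False using d by (simp add: mon_degree_def)
  qed
  then have "hilbert_function (sharp_ideal d :: 'k poly3 set) d
      = card {m. mon_degree m = d \<and> m \<notin> exponents (sharp_ideal d :: 'k poly3 set)}"
    by (rule hilbert_function_eq_card[OF sharp_ideal_monomial])
  then show ?thesis by (simp only: card_sharp_complement[OF d])
qed

lemma annihilates_sharpI:
  fixes F :: "nat \<Rightarrow> nat \<Rightarrow> nat \<Rightarrow> 'k::field"
  assumes "\<And>i j k. i + j + k = Suc n \<Longrightarrow> \<not> in_support i j k \<Longrightarrow> F i j k = 0"
    and "\<And>i j k. i + j + k = n \<Longrightarrow> a * F (Suc i) j k + b * F i (Suc j) k + c * F i j (Suc k) = 0"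
    and "i0 + j0 + k0 = Suc n" "F i0 j0 k0 \<noteq> 0"
  shows "\<exists>\<phi> m. annihilates a b c (sharp_ideal (Suc n)) n \<phi> \<and> mon_degree m = Suc n \<and> \<phi> m \<noteq> 0"
proof (intro exI conjI)
  let ?\<phi> = "\<lambda>m. F (Poly_Mapping.lookup m 0) (Poly_Mapping.lookup m 1) (Poly_Mapping.lookup m 2)"
  show "annihilates a b c (sharp_ideal (Suc n)) n ?\<phi>"
    unfolding annihilates_def
  proof (intro conjI ballI allI impI)
    fix m assume m: "m \<in> exponents (sharp_ideal (Suc n) :: 'k poly3 set)" "mon_degree m = Suc n"
    obtain i j k where ijk: "m = expo i j k" by (rule expo_cases)
    then show "?\<phi> m = 0" using m exponents_sharp_ideal[of i j k "Suc n", where 'k = 'k] assms(1)[of i j k] by simp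
  next
    fix m assume m: "mon_degree m = n"
    obtain i j k where ijk: "m = expo i j k" by (rule expo_cases)
    then show "a * ?\<phi> (m + expo 1 0 0) + b * ?\<phi> (m + expo 0 1 0) + c * ?\<phi> (m + expo 0 0 1) = 0"
      using m assms(2)[of i j k] by (simp add: expo_add)
  qed
  show "mon_degree (expo i0 j0 k0) = Suc n" "?\<phi> (expo i0 j0 k0) \<noteq> 0"
    using assms(3,4) by simp_all
qed

text \<open>For nonzero coefficients rescale the variables; if a coefficient vanishes, there is a functional supported
  on a single row of the triangle.\<close>

lemma annihilates_sharp:
  fixes a b c :: "'k::field_char_0"
  assumes n: "2 \<le> n"
  shows "\<exists>\<phi> m. annihilates a b c (sharp_ideal (Suc n)) n \<phi> \<and> mon_degree m = Suc n \<and> \<phi> m \<noteq> 0"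
proof -
  consider "a \<noteq> 0" "b \<noteq> 0" "c \<noteq> 0" | "a = 0" "b = 0" "c = 0" | "a = 0" "b \<noteq> 0 \<or> c \<noteq> 0"
    | "b = 0" "a \<noteq> 0 \<or> c \<noteq> 0" | "c = 0" "a \<noteq> 0" "b \<noteq> 0" by blast
  then show ?thesis
  proof cases
    case 1
    \<comment> \<open>Rescaling by a^(-i) b^(-j) c^(-k), multiplied by fixed powers of a, b, c so
      that no inverses occur.\<close>
    let ?F = "\<lambda>i j k. extremal_coeff i j k * (a ^ (Suc n - i) * b ^ (Suc n - j) * c ^ (Suc n - k)) :: 'k"
    show ?thesis
    proof (rule annihilates_sharpI[where F = ?F])
      fix i j k assume "i + j + k = n"
      then have "Suc n - i = Suc (n - i)" "Suc n - j = Suc (n - j)" "Suc n - k = Suc (n - k)" by simp_all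
      then have "a * ?F (Suc i) j k + b * ?F i (Suc j) k + c * ?F i j (Suc k)
          = (extremal_coeff (Suc i) j k + extremal_coeff i (Suc j) k + extremal_coeff i j (Suc k))
            * (a ^ Suc (n - i) * b ^ Suc (n - j) * c ^ Suc (n - k))"
        by (simp add: algebra_simps)
      then show "a * ?F (Suc i) j k + b * ?F i (Suc j) k + c * ?F i j (Suc k) = 0"
        by (simp only: extremal_coeff_rec mult_zero_left)
    next
      show "(n - 1) + 0 + 2 = Suc n" using n by simp
      show "?F (n - 1) 0 2 \<noteq> 0"
        using 1 extremal_coeff_nonzero_iff[of "n - 1" 0 2, where 'k = 'k] by (simp add: in_support_def)
    qed (use extremal_coeff_nonzero_iff[where 'k = 'k] in auto)
  next
    case 2
    show ?thesis
    proof (rule annihilates_sharpI[where F = extremal_coeff])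
      show "(n - 1) + 0 + 2 = Suc n" using n by simp
      show "extremal_coeff (n - 1) 0 2 \<noteq> (0 :: 'k)"
        using extremal_coeff_nonzero_iff[of "n - 1" 0 2, where 'k = 'k] by (simp add: in_support_def)
    qed (use 2 extremal_coeff_nonzero_iff[where 'k = 'k] in auto)
  next
    case 3
    \<comment> \<open>Dual to x^n (c y - b z): the only relation with a possibly nonzero term is at
      x^n, where it reads b c - c b = 0.\<close>
    let ?F = "\<lambda>(i::nat) (j::nat) (k::nat). if i = n \<and> j = 1 \<and> k = 0 then c else if i = n \<and> j = 0 \<and> k = 1 then - b else 0"
    obtain i0 j0 k0 where "i0 + j0 + k0 = Suc n" "?F i0 j0 k0 \<noteq> 0"
    proof (cases "c = 0")
      case True
      then show ?thesis using that[of n 0 1] 3 n by simp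
    next
      case False
      then show ?thesis using that[of n 1 0] n by simp
    qed
    then show ?thesis
      using n 3 by (intro annihilates_sharpI[where F = ?F and ?i0.0 = i0 and ?j0.0 = j0 and ?k0.0 = k0])
        (auto simp: in_support_def)
  next
    case 4
    let ?F = "\<lambda>(i::nat) (j::nat) (k::nat). if j = n \<and> i = 1 \<and> k = 0 then c else if j = n \<and> i = 0 \<and> k = 1 then - a else 0"
    obtain i0 j0 k0 where "i0 + j0 + k0 = Suc n" "?F i0 j0 k0 \<noteq> 0"
    proof (cases "c = 0")
      case True
      then show ?thesis using that[of 0 n 1] 4 n by simp
    next
      case False
      then show ?thesis using that[of 1 n 0] n by simp
    qed
    then show ?thesis
      using n 4 by (intro annihilates_sharpI[where F = ?F and ?i0.0 = i0 and ?j0.0 = j0 and ?k0.0 = k0])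
        (auto simp: in_support_def)
  next
    case 5
    \<comment> \<open>On row 2, which lies wholly in the support, the relation for a x + b y is
      solved by a geometric sequence.\<close>
    let ?F = "\<lambda>(i::nat) (j::nat) (k::nat). if k = 2 then a ^ j * (- b) ^ i else 0"
    show ?thesis
    proof (rule annihilates_sharpI[where F = ?F])
      show "(n - 1) + 0 + 2 = Suc n" using n by simp
    qed (use 5 in \<open>auto simp: in_support_def algebra_simps\<close>)
  qed
qed

text \<open>Every linear form must fail in degree d - 1. Surjectivity fails by the annihilating
  functional; injectivity fails because the target is no larger than the source, which is all of S
  in that degree.\<close>

lemma sharp_ideal_not_weak_lefschetz:
  assumes d: "3 \<le> d"
  shows "\<not> weak_lefschetz (sharp_ideal d :: 'k::field_char_0 poly3 set)"
proof
  let ?I = "sharp_ideal d :: 'k poly3 set"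
  assume "weak_lefschetz ?I"
  then obtain l where l: "l \<in> quot_part ?I 1"
    and max: "\<And>j. inj_on (\<lambda>u. l \<otimes>\<^bsub>poly3_ring Quot ?I\<^esub> u) (quot_part ?I j) \<or>
      (\<lambda>u. l \<otimes>\<^bsub>poly3_ring Quot ?I\<^esub> u) ` quot_part ?I j = quot_part ?I (Suc j)"
    unfolding weak_lefschetz_def by blast
  from l obtain f where "f \<in> homogeneous_part 1" "l = ?I +>\<^bsub>poly3_ring\<^esub> f"
    unfolding quot_part_def by blast
  then obtain a b c where l: "l = ?I +>\<^bsub>poly3_ring\<^esub> linear_form a b c"
    using homogeneous_part_1 by blast
  obtain n where n: "d = Suc n" "2 \<le> n" using d by (cases d) auto
  have ex: "\<exists>\<phi> m. annihilates a b c ?I n \<phi> \<and> mon_degree m = Suc n \<and> \<phi> m \<noteq> 0"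
    using annihilates_sharp[OF n(2), of a b c] by (simp only: n(1))
  then have "(\<lambda>u. l \<otimes>\<^bsub>poly3_ring Quot ?I\<^esub> u) ` quot_part ?I n \<noteq> quot_part ?I (Suc n)"
    unfolding l by (rule not_surj_iff[OF sharp_ideal_monomial, THEN iffD2])
  moreover have "\<not> inj_on (\<lambda>u. l \<otimes>\<^bsub>poly3_ring Quot ?I\<^esub> u) (quot_part ?I n)"
  proof -
    obtain \<phi> m where \<phi>: "annihilates a b c ?I n \<phi>" "mon_degree m = Suc n" "\<phi> m \<noteq> 0" using ex by blast
    have gen: "generated_in_degree (Suc n) ?I" using sharp_ideal_generated[of d] by (simp only: n(1))
    have "card {m. mon_degree m = Suc n \<and> m \<notin> exponents ?I} = (if odd d then 3 * d - 3 else 3 * d - 2)"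
      using card_sharp_complement[OF d, where 'k = 'k] by (simp only: n(1))
    moreover have "2 * card {m. mon_degree m = n} = (n + 1) * (n + 2)"
      using card_exponents_of_degree[of n "\<lambda>_. True"] card_triples[of n] by simp
    \<comment> \<open>Equality holds at d = 3 and d = 4, with dimensions 6 and 10.\<close>
    moreover have "2 * (if odd d then 3 * d - 3 else 3 * d - 2) \<le> (n + 1) * (n + 2)"
    proof (cases "n = 2")
      case False
      define y where "y = n - 3"
      have "n = y + 3" using False n by (simp add: y_def)
      then show ?thesis by (simp add: n(1) algebra_simps)
    qed (simp add: n(1))
    ultimately have "card {m. mon_degree m = Suc n \<and> m \<notin> exponents ?I} \<le> card {m. mon_degree m = n}"
      by linarith
    then show ?thesis
      unfolding l by (rule not_inj_if_annihilated[OF sharp_ideal_monomial gen \<phi>])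
  qed
  ultimately show False using max[of n] by simp
qed

text \<open>Sharpness starts at d = 3: for d = 2 the bound is 4, while an artinian monomial ideal
  generated by quadrics contains all three squares and leaves at most 3 monomials, so no failing
  ideal exists.\<close>

theorem theorem1p1:
  shows "(\<forall>d \<ge> 2. \<forall>I :: 'k::field_char_0 poly3 set.
            artinian_ideal I \<and> monomial_ideal I \<and> generated_in_degree d I \<and>
            \<not> weak_lefschetz I \<longrightarrow>
            hilbert_function I d \<ge> (if odd d then 3 * d - 3 else 3 * d - 2)) \<and>
         (\<forall>d \<ge> 3. \<exists>I :: 'k poly3 set.
            artinian_ideal I \<and> monomial_ideal I \<and> generated_in_degree d I \<and>
            \<not> weak_lefschetz I \<and>
            hilbert_function I d = (if odd d then 3 * d - 3 else 3 * d - 2))"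
proof (intro conjI allI impI)
  fix d :: nat and I :: "'k poly3 set"
  assume "2 \<le> d" "artinian_ideal I \<and> monomial_ideal I \<and> generated_in_degree d I \<and> \<not> weak_lefschetz I"
  then show "hilbert_function I d \<ge> (if odd d then 3 * d - 3 else 3 * d - 2)"
    using hilbert_lower_bound[of d I] by blast
next
  fix d :: nat assume "3 \<le> d"
  then show "\<exists>I :: 'k poly3 set. artinian_ideal I \<and> monomial_ideal I \<and> generated_in_degree d I \<and>
      \<not> weak_lefschetz I \<and> hilbert_function I d = (if odd d then 3 * d - 3 else 3 * d - 2)"
    using sharp_ideal_artinian sharp_ideal_monomial sharp_ideal_generated
      sharp_ideal_not_weak_lefschetz hilbert_sharp_ideal by blast
qed

end
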